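(* Let $a\in L^1(I)$. The eigenvalues of the periodic problem on $[0,4T]$ with potential $\tilde{\tilde a}$ are exactly the numbers $\lambda_k^{N,T},\lambda_k^{D,T},\lambda_k^{M_1,T},\lambda_k^{M_2,T}$ ($k=0,1,2,\dots$), and they always appear in the order $$\lambda_0^{N,T}<\{\lambda_0^{M_1,T},\lambda_0^{M_2,T}\}<\{\lambda_0^{D,T},\lambda_1^{N,T}\}<\{\lambda_1^{M_1,T},\lambda_1^{M_2,T}\}<\{\lambda_1^{D,T},\lambda_2^{N,T}\}<\cdots,$$ where $\{x,y\}<\{z,w\}$ means $\max\{x,y\}<\min\{z,w\}$ (no order is asserted inside each pair, whose two members may coincide). That is, $\lambda_0^{N,T}<\min\{\lambda_0^{M_1,T},\lambda_0^{M_2,T}\}$ and, for every $k\ge 0$, $$\max\{\lambda_k^{M_1,T},\lambda_k^{M_2,T}\}<\min\{\lambda_k^{D,T},\lambda_{k+1}^{N,T}\}\quad\text{and}\quad \max\{\lambda_k^{D,T},\lambda_{k+1}^{N,T}\}<\min\{\lambda_{k+1}^{M_1,T},\lambda_{k+1}^{M_2,T}\}.$$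
   Context: Fix $T>0$ and put $I=[0,T]$. $\tilde a$ is the even extension of $a$ to $[0,2T]$: $\tilde a(t)=a(t)$ on $[0,T]$, $\tilde a(t)=a(2T-t)$ on $(T,2T]$; $\tilde{\tilde a}$ is the even extension of $\tilde a$ to $[0,4T]$: $\tilde{\tilde a}(t)=\tilde a(t)$ on $[0,2T]$, $\tilde{\tilde a}(t)=\tilde a(4T-t)$ on $(2T,4T]$. An eigenvalue of a boundary value problem on $[0,S]$ with potential $q$ is a $\lambda\in\mathbb{R}$ for which $u''+(q(t)+\lambda)u=0$ a.e. on $[0,S]$ has a nontrivial solution ($u\in C^1[0,S]$, $u'$ absolutely continuous) satisfying the boundary condition. The periodic condition on $[0,4T]$ is $u(0)=u(4T)$, $u'(0)=u'(4T)$. $\lambda_0^{B,T}<\lambda_1^{B,T}<\cdots$ denote the eigenvalues (all simple) in increasing order of the problem on $[0,T]$ with potential $a$ and boundary condition $B$, where $B=N$: $u'(0)=u'(T)=0$; $B=D$: $u(0)=u(T)=0$; $B=M_1$: $u'(0)=u(T)=0$; $B=M_2$: $u(0)=u'(T)=0$. *)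

theory Defs
  imports "HOL-Analysis.Analysis"
begin

definition even_ext :: "real \<Rightarrow> (real \<Rightarrow> real) \<Rightarrow> real \<Rightarrow> real" where
  "even_ext S q = (\<lambda>t. if t \<le> S then q t else q (2 * S - t))"

(* The members of a division are finitely many nonempty compact intervals with pairwise
   disjoint interiors; such an interval k is [Inf k, Sup k]. *)
definition abs_continuous_on :: "real set \<Rightarrow> (real \<Rightarrow> real) \<Rightarrow> bool" where
  "abs_continuous_on J f \<longleftrightarrow>
     (\<forall>\<epsilon>>0. \<exists>\<delta>>0. \<forall>d. d division_of \<Union>d \<and> \<Union>d \<subseteq> J \<and> (\<Sum>k\<in>d. Sup k - Inf k) < \<delta>
        \<longrightarrow> (\<Sum>k\<in>d. \<bar>f (Sup k) - f (Inf k)\<bar>) < \<epsilon>)"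

(* u'' + (q + l) u = 0 a.e. on [0,S], with v in the role of u'; derivatives are
   one-sided at the endpoints. *)
definition is_solution ::
  "real \<Rightarrow> (real \<Rightarrow> real) \<Rightarrow> real \<Rightarrow> (real \<Rightarrow> real) \<Rightarrow> (real \<Rightarrow> real) \<Rightarrow> bool" where
  "is_solution S q l u v \<longleftrightarrow>
     (\<forall>t\<in>{0..S}. (u has_real_derivative v t) (at t within {0..S})) \<and>
     continuous_on {0..S} v \<and>
     abs_continuous_on {0..S} v \<and>
     (AE t in lebesgue_on {0..S}. \<exists>w. (v has_real_derivative w) (at t within {0..S}) \<and>
        w + (q t + l) * u t = 0)"

(* Arguments of a boundary condition, in this order: u(0), u'(0), u(S), u'(S). *)
type_synonym boundary_condition = "real \<Rightarrow> real \<Rightarrow> real \<Rightarrow> real \<Rightarrow> bool"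

definition bc_N :: boundary_condition where
  "bc_N u0 v0 uS vS \<longleftrightarrow> v0 = 0 \<and> vS = 0"

definition bc_D :: boundary_condition where
  "bc_D u0 v0 uS vS \<longleftrightarrow> u0 = 0 \<and> uS = 0"

definition bc_M1 :: boundary_condition where
  "bc_M1 u0 v0 uS vS \<longleftrightarrow> v0 = 0 \<and> uS = 0"

definition bc_M2 :: boundary_condition where
  "bc_M2 u0 v0 uS vS \<longleftrightarrow> u0 = 0 \<and> vS = 0"

definition bc_periodic :: boundary_condition where
  "bc_periodic u0 v0 uS vS \<longleftrightarrow> u0 = uS \<and> v0 = vS"

definition eigenvalues :: "boundary_condition \<Rightarrow> real \<Rightarrow> (real \<Rightarrow> real) \<Rightarrow> real set" where
  "eigenvalues B S q =
     {l. \<exists>u v. is_solution S q l u v \<and> (\<exists>t\<in>{0..S}. u t \<noteq> 0) \<and> B (u 0) (v 0) (u S) (v S)}"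

(* The sequence is unspecified unless the eigenvalues can be listed as
   l_0 < l_1 < l_2 < ... (the listing is then unique), so any nontrivial statement about
   it carries the obligation to show that they can. *)
definition eigenvalue :: "boundary_condition \<Rightarrow> real \<Rightarrow> (real \<Rightarrow> real) \<Rightarrow> nat \<Rightarrow> real" where
  "eigenvalue B S q = (THE f. strict_mono f \<and> range f = eigenvalues B S q)"

end

theory Submission
  imports Defs
begin

text \<open>
Let \<open>m\<close> be the mean of the potential \<open>q\<close> on \<open>[0, S]\<close> and let \<open>\<sigma>\<close> be the primitive of \<open>q - m\<close>
with \<open>\<sigma>(0) = 0\<close>; then also \<open>\<sigma>(S) = 0\<close>.  In terms of \<open>w = u' + \<sigma> u\<close> the equation
\<open>u'' + (q + \<lambda>) u = 0\<close> reads
\<open>u' = w - \<sigma> u\<close>, \<open>w' = \<sigma> w - (\<kappa> + \<sigma>\<^sup>2) u\<close> with \<open>\<kappa> = \<lambda> + m\<close>.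
Its coefficients are continuous although \<open>q\<close> is only integrable, so its solutions are classical
\<open>C\<^sup>1\<close> functions, and \<open>w = u'\<close> at both end points, so boundary conditions are not affected
(\<open>is_solution_iff_reg_system\<close>, \<open>eigenvalue_iff_reg_system\<close>).  Absolute continuity enters only in this
translation, through the fundamental theorem of calculus \<open>abs_continuous_on_FTC\<close> and the
differentiation theorem \<open>integral_has_derivative_AE\<close>.

For the order of the eigenvalues, let \<open>c\<close> and \<open>s\<close> be the solutions on \<open>[0, T]\<close> with
\<open>(c, c')(0) = (1, 0)\<close> and \<open>(s, s')(0) = (0, 1)\<close>, and let \<open>P(\<kappa>)\<close> and \<open>Q(\<kappa>)\<close> be the polar
(Pruefer) angles of the points \<open>(c', c)(T)\<close> and \<open>(s', s)(T)\<close> of the plane.  Each angle is continuous in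
\<open>\<kappa>\<close>; it is strictly increasing by the Wronskian identity for two parameters
(\<open>angle_strict_mono\<close>); it lies in the open first quadrant for very negative \<open>\<kappa>\<close>
(\<open>angle_first_quadrant\<close>) and is unbounded (\<open>angle_unbounded\<close>).  Hence the eigenvalues for
\<open>N\<close>, \<open>M\<^sub>1\<close>, \<open>M\<^sub>2\<close>, \<open>D\<close> are exactly the points where
\<open>P = \<pi>/2 + k\<pi>\<close>, \<open>P = (k+1)\<pi>\<close>, \<open>Q = \<pi>/2 + k\<pi>\<close>, \<open>Q = (k+1)\<pi>\<close>, one for each \<open>k\<close>.
As \<open>c s' - c' s = 1\<close>, the second point is never on the line through the origin and the first one, which gives
\<open>Q < P < Q + \<pi>\<close> (\<open>angle_gap\<close>).  All the asserted inequalities can be read off from that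
(\<open>interlacing_of_angles\<close>).

For the periodic problem, the primitive \<open>\<tau>\<close> of the doubly reflected potential consists of four
copies of \<open>\<plusminus>\<sigma>\<close>, so a solution on \<open>[0, 4T]\<close> consists of four solutions on \<open>[0, T]\<close>, read
alternately forwards and backwards, each a linear combination of \<open>c\<close> and \<open>s\<close>.  The
conditions that the pieces fit together decouple after taking sums and differences, and a nontrivial periodic
solution exists if and only if one of \<open>c(T)\<close>, \<open>s(T)\<close>, \<open>c'(T)\<close>, \<open>s'(T)\<close> vanishes
(\<open>periodic_matching\<close>), that is, if and only if \<open>\<lambda>\<close> is an eigenvalue of one of the four
separated problems.
\<close>

section \<open>Absolutely continuous functions\<close>

lemma division_interval:
  fixes d :: "real set set"
  assumes "d division_of U" "k \<in> d"
  shows "k = {Inf k..Sup k}" "Inf k \<le> Sup k" "Inf k \<in> U" "Sup k \<in> U"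
proof -
  obtain a b where ab: "k = {a..b}" "k \<noteq> {}" "k \<subseteq> U"
    using division_ofD(2,3,4)[OF assms] by (metis box_real(2))
  then show "k = {Inf k..Sup k}" "Inf k \<le> Sup k" "Inf k \<in> U" "Sup k \<in> U" by auto
qed

text \<open>The closure properties needed below (sums, differences, products of bounded functions, Lipschitz functions) are all instances of this comparison of increments.\<close>

lemma abs_continuous_on_dominated:
  assumes f: "abs_continuous_on J f" and g: "abs_continuous_on J g"
    and le: "\<And>x y. x \<in> J \<Longrightarrow> y \<in> J \<Longrightarrow> \<bar>h y - h x\<bar> \<le> C * (\<bar>f y - f x\<bar> + \<bar>g y - g x\<bar>)"
  shows "abs_continuous_on J h"
  unfolding abs_continuous_on_def
proof (intro allI impI)
  fix e :: real assume "e > 0"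
  define D where "D = \<bar>C\<bar> + 1"
  have pos: "D > 0" by (simp add: D_def)
  define e' where "e' = e / (2 * D)"
  have e': "e' > 0" using \<open>e > 0\<close> pos by (auto simp: e'_def)
  obtain d1 where d1: "d1 > 0" "\<forall>d. d division_of \<Union>d \<and> \<Union>d \<subseteq> J \<and> (\<Sum>k\<in>d. Sup k - Inf k) < d1
        \<longrightarrow> (\<Sum>k\<in>d. \<bar>f (Sup k) - f (Inf k)\<bar>) < e'" using f e' unfolding abs_continuous_on_def by blast
  obtain d2 where d2: "d2 > 0" "\<forall>d. d division_of \<Union>d \<and> \<Union>d \<subseteq> J \<and> (\<Sum>k\<in>d. Sup k - Inf k) < d2
        \<longrightarrow> (\<Sum>k\<in>d. \<bar>g (Sup k) - g (Inf k)\<bar>) < e'" using g e' unfolding abs_continuous_on_def by blast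
  show "\<exists>\<delta>>0. \<forall>d. d division_of \<Union> d \<and> \<Union> d \<subseteq> J \<and> (\<Sum>k\<in>d. Sup k - Inf k) < \<delta> \<longrightarrow>
       (\<Sum>k\<in>d. \<bar>h (Sup k) - h (Inf k)\<bar>) < e"
  proof (intro exI[of _ "min d1 d2"] conjI allI impI)
    show "min d1 d2 > 0" using d1 d2 by auto
    fix d :: "real set set" assume "d division_of \<Union> d \<and> \<Union> d \<subseteq> J \<and> (\<Sum>k\<in>d. Sup k - Inf k) < min d1 d2"
    then have d: "d division_of \<Union> d" "\<Union> d \<subseteq> J" "(\<Sum>k\<in>d. Sup k - Inf k) < d1" "(\<Sum>k\<in>d. Sup k - Inf k) < d2" by auto
    have "(\<Sum>k\<in>d. \<bar>h (Sup k) - h (Inf k)\<bar>) \<le>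
      (\<Sum>k\<in>d. D * (\<bar>f (Sup k) - f (Inf k)\<bar> + \<bar>g (Sup k) - g (Inf k)\<bar>))"
    proof (rule sum_mono)
      fix k assume k: "k \<in> d"
      have "\<bar>h (Sup k) - h (Inf k)\<bar> \<le> C * (\<bar>f (Sup k) - f (Inf k)\<bar> + \<bar>g (Sup k) - g (Inf k)\<bar>)"
        using le division_interval[OF d(1) k] d(2) by blast
      also have "\<dots> \<le> D * (\<bar>f (Sup k) - f (Inf k)\<bar> + \<bar>g (Sup k) - g (Inf k)\<bar>)"
        by (intro mult_right_mono) (auto simp: D_def)
      finally show "\<bar>h (Sup k) - h (Inf k)\<bar> \<le> D * (\<bar>f (Sup k) - f (Inf k)\<bar> + \<bar>g (Sup k) - g (Inf k)\<bar>)" .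
    qed
    also have "\<dots> = D * ((\<Sum>k\<in>d. \<bar>f (Sup k) - f (Inf k)\<bar>) + (\<Sum>k\<in>d. \<bar>g (Sup k) - g (Inf k)\<bar>))"
      by (simp add: sum.distrib flip: sum_distrib_left)
    also have "\<dots> < D * (e' + e')"
      using d1(2) d2(2) d pos by (intro mult_strict_left_mono add_strict_mono) auto
    also have "\<dots> = e" using pos by (simp add: e'_def field_simps)
    finally show "(\<Sum>k\<in>d. \<bar>h (Sup k) - h (Inf k)\<bar>) < e" .
  qed
qed

lemma abs_continuous_on_id: "abs_continuous_on J (\<lambda>x. x)"
  unfolding abs_continuous_on_def
proof (intro allI impI)
  fix e :: real assume "e > 0"
  show "\<exists>\<delta>>0. \<forall>d. d division_of \<Union> d \<and> \<Union> d \<subseteq> J \<and> (\<Sum>k\<in>d. Sup k - Inf k) < \<delta> \<longrightarrow>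
       (\<Sum>k\<in>d. \<bar>Sup k - Inf k\<bar>) < e"
  proof (intro exI[of _ e] conjI allI impI, fact)
    fix d :: "real set set" assume "d division_of \<Union> d \<and> \<Union> d \<subseteq> J \<and> (\<Sum>k\<in>d. Sup k - Inf k) < e"
    moreover from this have "(\<Sum>k\<in>d. \<bar>Sup k - Inf k\<bar>) = (\<Sum>k\<in>d. Sup k - Inf k)"
      by (intro sum.cong refl) (use division_interval(2) in force)
    ultimately show "(\<Sum>k\<in>d. \<bar>Sup k - Inf k\<bar>) < e" by simp
  qed
qed

lemma abs_continuous_on_subset:
  "abs_continuous_on J f \<Longrightarrow> I \<subseteq> J \<Longrightarrow> abs_continuous_on I f"
  unfolding abs_continuous_on_def by (meson order_trans)

lemma abs_continuous_on_lipschitz: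
  assumes "\<And>x y. x \<in> J \<Longrightarrow> y \<in> J \<Longrightarrow> \<bar>h y - h x\<bar> \<le> C * \<bar>y - x\<bar>"
  shows "abs_continuous_on J h"
  by (rule abs_continuous_on_dominated[OF abs_continuous_on_id abs_continuous_on_id, where C = "C / 2"])
    (use assms in auto)

lemma abs_continuous_on_add:
  "abs_continuous_on J f \<Longrightarrow> abs_continuous_on J g \<Longrightarrow> abs_continuous_on J (\<lambda>x. f x + g x)"
  by (erule (1) abs_continuous_on_dominated[where C = 1]) auto

lemma abs_continuous_on_diff:
  "abs_continuous_on J f \<Longrightarrow> abs_continuous_on J g \<Longrightarrow> abs_continuous_on J (\<lambda>x. f x - g x)"
  by (erule (1) abs_continuous_on_dominated[where C = 1]) auto

lemma abs_continuous_on_mult: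
  assumes "abs_continuous_on J f" "abs_continuous_on J g"
    and f: "\<And>x. x \<in> J \<Longrightarrow> \<bar>f x\<bar> \<le> C" and g: "\<And>x. x \<in> J \<Longrightarrow> \<bar>g x\<bar> \<le> C"
  shows "abs_continuous_on J (\<lambda>x. f x * g x)"
proof (rule abs_continuous_on_dominated[OF assms(1,2), where C = C])
  fix x y assume xy: "x \<in> J" "y \<in> J"
  have "f y * g y - f x * g x = (f y - f x) * g y + f x * (g y - g x)" by (simp add: algebra_simps)
  also have "\<bar>\<dots>\<bar> \<le> \<bar>f y - f x\<bar> * \<bar>g y\<bar> + \<bar>f x\<bar> * \<bar>g y - g x\<bar>"
    by (metis abs_mult abs_triangle_ineq)
  also have "\<dots> \<le> \<bar>f y - f x\<bar> * C + C * \<bar>g y - g x\<bar>"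
    by (intro add_mono mult_left_mono mult_right_mono) (use xy f g in auto)
  finally show "\<bar>f y * g y - f x * g x\<bar> \<le> C * (\<bar>f y - f x\<bar> + \<bar>g y - g x\<bar>)" by (simp add: algebra_simps)
qed

lemma abs_continuous_on_C1:
  assumes f: "\<And>x. x \<in> {a..b} \<Longrightarrow> (f has_real_derivative f' x) (at x within {a..b})"
    and f': "continuous_on {a..b} f'"
  shows "abs_continuous_on {a..b} f"
proof -
  have "compact (f' ` {a..b})" using f' by (intro compact_continuous_image) auto
  then have "bounded (f' ` {a..b})" by (rule compact_imp_bounded)
  then obtain C where C: "\<And>x. x \<in> {a..b} \<Longrightarrow> norm (f' x) \<le> C"
    unfolding bounded_iff by (metis image_eqI)
  show ?thesis
  proof (rule abs_continuous_on_lipschitz)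
    fix x y assume "x \<in> {a..b}" "y \<in> {a..b}"
    then show "\<bar>f y - f x\<bar> \<le> C * \<bar>y - x\<bar>"
      using field_differentiable_bound[of "{a..b}" f f' C x y] f C by (auto simp: abs_minus_commute)
  qed
qed

text \<open>Split \<open>\<bar>g\<bar>\<close> into its truncation at height \<open>n\<close> and a remainder. By dominated convergence the remainder has small integral for large \<open>n\<close>, and the truncation contributes at most \<open>n\<close> times the total length.\<close>

lemma abs_continuous_on_integral:
  fixes g :: "real \<Rightarrow> real"
  assumes g: "g absolutely_integrable_on {0..S}"
  shows "abs_continuous_on {0..S} (\<lambda>t. integral {0..t} g)"
  unfolding abs_continuous_on_def
proof (intro allI impI)
  fix e :: real assume e: "e > 0"
  have ag: "(\<lambda>x. \<bar>g x\<bar>) absolutely_integrable_on {0..S}"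
    using absolutely_integrable_norm[OF g] by (simp add: comp_def)
  define h where "h = (\<lambda>n x. \<bar>g x\<bar> - min \<bar>g x\<bar> (real n))"
  have hi: "h n absolutely_integrable_on {0..S}" for n
    unfolding h_def
    by (intro set_integral_diff ag absolutely_integrable_min_1) (auto intro!: absolutely_integrable_continuous_real)
  have lim: "(\<lambda>n. integral {0..S} (h n)) \<longlonglongrightarrow> integral {0..S} (\<lambda>x. 0)"
  proof (rule dominated_convergence(2)[where h = "\<lambda>x. \<bar>g x\<bar>"])
    show "h n integrable_on {0..S}" for n using hi set_lebesgue_integral_eq_integral(1) by blast
    show "(\<lambda>x. \<bar>g x\<bar>) integrable_on {0..S}" using ag set_lebesgue_integral_eq_integral(1) by blast
    show "norm (h n x) \<le> \<bar>g x\<bar>" for n x by (auto simp: h_def)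
    fix x
    have "eventually (\<lambda>n. h n x = 0) sequentially"
      using eventually_ge_at_top[of "nat \<lceil>\<bar>g x\<bar>\<rceil>"] by eventually_elim (auto simp: h_def min_def nat_le_iff ceiling_le_iff)
    then show "(\<lambda>n. h n x) \<longlonglongrightarrow> 0" by (simp add: tendsto_eventually)
  qed
  have "eventually (\<lambda>n. integral {0..S} (h n) < e / 2) sequentially"
    using order_tendstoD(2)[OF lim, of "e / 2"] e by simp
  then obtain n where n: "integral {0..S} (h n) < e / 2" unfolding eventually_sequentially by blast
  define \<delta> where "\<delta> = e / (2 * (real n + 1))"
  have d0: "\<delta> > 0" using e by (simp add: \<delta>_def)
  show "\<exists>\<delta>>0. \<forall>d. d division_of \<Union>d \<and> \<Union>d \<subseteq> {0..S} \<and> (\<Sum>k\<in>d. Sup k - Inf k) < \<delta>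
        \<longrightarrow> (\<Sum>k\<in>d. \<bar>integral {0..Sup k} g - integral {0..Inf k} g\<bar>) < e"
  proof (intro exI[of _ \<delta>] conjI allI impI, fact)
    fix d :: "real set set" assume "d division_of \<Union> d \<and> \<Union> d \<subseteq> {0..S} \<and> (\<Sum>k\<in>d. Sup k - Inf k) < \<delta>"
    then have d: "d division_of \<Union> d" "\<Union> d \<subseteq> {0..S}" "(\<Sum>k\<in>d. Sup k - Inf k) < \<delta>" by auto
    have "(\<Sum>k\<in>d. \<bar>integral {0..Sup k} g - integral {0..Inf k} g\<bar>)
       \<le> (\<Sum>k\<in>d. integral k (h n) + real n * (Sup k - Inf k))"
    proof (rule sum_mono)
      fix k assume k: "k \<in> d"
      note K = division_interval[OF d(1) k]
      have KS: "0 \<le> Inf k" "Sup k \<le> S" using K d(2) by auto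
      have kS: "{Inf k..Sup k} \<subseteq> {0..S}" using KS by auto
      have gi: "g integrable_on {0..S}" using g set_lebesgue_integral_eq_integral(1) by blast
      have gi': "g integrable_on {0..Sup k}" by (rule integrable_on_subinterval[OF gi]) (use KS in auto)
      have hk: "h n integrable_on {Inf k..Sup k}"
        by (rule integrable_on_subinterval[OF _ kS]) (use hi set_lebesgue_integral_eq_integral(1) in blast)
      have ci: "(\<lambda>x. h n x + real n) integrable_on {Inf k..Sup k}"
        by (intro integrable_add hk) auto
      have "integral {0..Inf k} g + integral {Inf k..Sup k} g = integral {0..Sup k} g"
        using Henstock_Kurzweil_Integration.integral_combine[OF KS(1) K(2) gi'] .
      then have "\<bar>integral {0..Sup k} g - integral {0..Inf k} g\<bar> = norm (integral {Inf k..Sup k} g)" by auto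
      also have "\<dots> \<le> integral {Inf k..Sup k} (\<lambda>x. h n x + real n)"
        by (rule integral_norm_bound_integral[OF integrable_on_subinterval[OF gi kS] ci]) (auto simp: h_def)
      also have "\<dots> = integral {Inf k..Sup k} (h n) + real n * (Sup k - Inf k)"
        using hk K(2) by (subst Henstock_Kurzweil_Integration.integral_add) auto
      finally show "\<bar>integral {0..Sup k} g - integral {0..Inf k} g\<bar> \<le> integral k (h n) + real n * (Sup k - Inf k)"
        using K(1) by simp
    qed
    also have "\<dots> = (\<Sum>k\<in>d. integral k (h n)) + real n * (\<Sum>k\<in>d. Sup k - Inf k)"
      by (simp add: sum.distrib sum_distrib_left)
    also have "(\<Sum>k\<in>d. integral k (h n)) \<le> integral {0..S} (h n)"
    proof -
      have int: "h n integrable_on k" if "k \<in> d" for k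
      proof -
        have "Inf k \<in> {0..S}" "Sup k \<in> {0..S}" using division_interval(3,4)[OF d(1) that] d(2) by blast+
        then have "{Inf k..Sup k} \<subseteq> {0..S}" by auto
        then have "h n integrable_on {Inf k..Sup k}"
          using hi set_lebesgue_integral_eq_integral(1) integrable_on_subinterval by blast
        then show ?thesis using division_interval(1)[OF d(1) that] by simp
      qed
      have "(\<Sum>k\<in>d. integral k (h n)) = integral (\<Union>d) (h n)"
        using integral_combine_division_bottomup[OF d(1) int] by simp
      also have "\<dots> \<le> integral {0..S} (h n)"
        by (rule integral_subset_le[OF d(2)])
          (use hi set_lebesgue_integral_eq_integral(1) integrable_combine_division[OF d(1) int] in \<open>auto simp: h_def\<close>)
      finally show ?thesis .
    qed
    also have "integral {0..S} (h n) + real n * (\<Sum>k\<in>d. Sup k - Inf k) < e / 2 + (real n + 1) * \<delta>"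
      using n d(3) d0 by (intro add_less_le_mono mult_mono) (auto intro!: sum_nonneg dest: division_interval(2)[OF d(1)])
    also have "\<dots> = e" by (simp add: \<delta>_def field_simps)
    finally show "(\<Sum>k\<in>d. \<bar>integral {0..Sup k} g - integral {0..Inf k} g\<bar>) < e" by simp
  qed
qed


lemma negligible_uminus_vimage:
  fixes N :: "real set"
  assumes "negligible N" shows "negligible (uminus -` N)"
proof -
  have "negligible (uminus ` N)"
    by (rule negligible_differentiable_image_negligible[OF order_refl assms])
      (auto intro!: derivative_intros simp: differentiable_on_def)
  moreover have "uminus -` N = uminus ` N" by force
  ultimately show ?thesis by simp
qed

text \<open>The differentiation theorem for cubes \<open>[x, x + h]\<close> yields the derivative from the right; applied to \<open>x \<mapsto> g(-x)\<close> it yields the derivative from the left.\<close>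

lemma integral_has_derivative_AE:
  fixes g :: "real \<Rightarrow> real"
  assumes g: "g integrable_on {0..S}"
  obtains N where "negligible N"
    "\<And>t. t \<in> {0..S} - N \<Longrightarrow> ((\<lambda>t. integral {0..t} g) has_real_derivative g t) (at t within {0..S})"
proof -
  define f where "f = (\<lambda>x. if x \<in> {0..S} then g x else 0)"
  have f: "f integrable_on cbox a b" for a b
  proof -
    have "f integrable_on UNIV" unfolding f_def using g by (simp only: integrable_restrict_UNIV)
    then show ?thesis using integrable_on_subcbox by blast
  qed
  have f': "(\<lambda>x. f (- x)) integrable_on cbox a b" for a b
    using f[of "- b" "- a"] Henstock_Kurzweil_Integration.integrable_reflect_real[where f=f and a="-b" and b="-a"] by simp
  obtain N1 where N1: "negligible N1" "\<And>x e. \<lbrakk>x \<notin> N1; 0 < e\<rbrakk> \<Longrightarrow> \<exists>d>0. \<forall>h. 0 < h \<and> h < d \<longrightarrow>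
       norm (integral (cbox x (x + h *\<^sub>R One)) f /\<^sub>R h ^ DIM(real) - f x) < e"
    using integrable_ccontinuous_explicit[OF f] by blast
  obtain N2 where N2: "negligible N2" "\<And>x e. \<lbrakk>x \<notin> N2; 0 < e\<rbrakk> \<Longrightarrow> \<exists>d>0. \<forall>h. 0 < h \<and> h < d \<longrightarrow>
       norm (integral (cbox x (x + h *\<^sub>R One)) (\<lambda>x. f (- x)) /\<^sub>R h ^ DIM(real) - f (- x)) < e"
    using integrable_ccontinuous_explicit[OF f'] by blast
  have "negligible (N1 \<union> uminus -` N2)" using N1(1) N2(1) negligible_uminus_vimage by auto
  moreover have "((\<lambda>t. integral {0..t} g) has_real_derivative g t) (at t within {0..S})"
    if t: "t \<in> {0..S} - (N1 \<union> uminus -` N2)" for t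
    unfolding has_field_derivative_iff Lim_within
  proof (intro allI impI)
    fix e :: real assume e: "e > 0"
    obtain d1 where d1: "d1 > 0" "\<And>h. 0 < h \<Longrightarrow> h < d1 \<Longrightarrow> \<bar>integral {t..t + h} f / h - f t\<bar> < e"
      using N1(2)[of t e] t e by (auto simp: divide_inverse_commute)
    obtain d2 where d2: "d2 > 0" "\<And>h. 0 < h \<Longrightarrow> h < d2 \<Longrightarrow> \<bar>integral {-t..-t + h} (\<lambda>x. f (-x)) / h - f t\<bar> < e"
      using N2(2)[of "-t" e] t e by (auto simp: divide_inverse_commute)
    have diff: "integral {0..y} g - integral {0..x} g = integral {x..y} f" if "0 \<le> x" "x \<le> y" "y \<le> S" for x y
    proof -
      have "g integrable_on {0..y}" by (rule integrable_on_subinterval[OF g]) (use that in auto)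
      then have "integral {0..x} g + integral {x..y} g = integral {0..y} g"
        using that by (intro Henstock_Kurzweil_Integration.integral_combine) auto
      moreover have "integral {x..y} g = integral {x..y} f"
        by (rule Henstock_Kurzweil_Integration.integral_cong) (use that in \<open>auto simp: f_def\<close>)
      ultimately show ?thesis by simp
    qed
    have ft: "f t = g t" using t by (simp add: f_def)
    show "\<exists>d>0. \<forall>y\<in>{0..S}. 0 < dist y t \<and> dist y t < d \<longrightarrow>
        dist ((integral {0..y} g - integral {0..t} g) / (y - t)) (g t) < e"
    proof (intro exI[of _ "min d1 d2"] conjI ballI impI)
      show "min d1 d2 > 0" using d1 d2 by simp
      fix y assume y: "y \<in> {0..S}" "0 < dist y t \<and> dist y t < min d1 d2"
      consider "y > t" | "y < t" using y by force
      then show "dist ((integral {0..y} g - integral {0..t} g) / (y - t)) (g t) < e"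
      proof cases
        case 1
        then show ?thesis using d1(2)[of "y - t"] diff[of t y] y t ft by (simp add: dist_real_def)
      next
        case 2
        have "integral {-t..-y} (\<lambda>x. f (- x)) = integral {y..t} f"
          by (rule Henstock_Kurzweil_Integration.integral_reflect_real)
        then have "(integral {0..y} g - integral {0..t} g) / (y - t) = integral {-t..-t + (t - y)} (\<lambda>x. f (-x)) / (t - y)"
          using diff[of y t] 2 y t by (simp add: field_simps)
        then show ?thesis using d2(2)[of "t - y"] y 2 ft by (simp add: dist_real_def)
      qed
    qed
  qed
  ultimately show ?thesis using that by blast
qed

text \<open>Choose the gauge such that every fine interval tagged in the exceptional set \<open>N\<close> lies in an open set of measure less than \<open>\<delta>\<close>. Absolute continuity bounds the total increment of \<open>f\<close> over those intervals, and on the others \<open>f\<close> is close to its linear approximation at the tag.\<close>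

lemma abs_continuous_on_FTC:
  fixes f g :: "real \<Rightarrow> real"
  assumes f: "abs_continuous_on {a..b} f" and ab: "a \<le> b" and N: "negligible N"
    and deriv: "\<And>t. t \<in> {a..b} - N \<Longrightarrow> (f has_real_derivative g t) (at t within {a..b})"
  shows "(g has_integral f b - f a) {a..b}"
proof -
  define g0 where "g0 = (\<lambda>x. if x \<in> N then 0 else g x)"
  have "(g0 has_integral f b - f a) {a..b}"
    unfolding has_integral_real
  proof (intro allI impI)
    fix e :: real assume e: "e > 0"
    define e1 where "e1 = e / (2 * (b - a + 1))"
    have e1: "e1 > 0" using e ab by (simp add: e1_def)
    obtain \<delta> where \<delta>: "\<delta> > 0" "\<forall>d. d division_of \<Union>d \<and> \<Union>d \<subseteq> {a..b} \<and> (\<Sum>k\<in>d. Sup k - Inf k) < \<delta>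
        \<longrightarrow> (\<Sum>k\<in>d. \<bar>f (Sup k) - f (Inf k)\<bar>) < e / 2"
      using f e unfolding abs_continuous_on_def by (meson half_gt_zero)
    obtain U where U: "open U" "N \<subseteq> U" "U - N \<in> lmeasurable" "emeasure lebesgue (U - N) < ennreal \<delta>"
      using sets_lebesgue_outer_open[OF negligible_imp_sets[OF N] \<delta>(1)] by blast
    have Nm: "N \<in> lmeasurable" "measure lebesgue N = 0" using N by (auto simp: negligible_iff_measure)
    have UN: "U = N \<union> (U - N)" using U(2) by auto
    have Um: "U \<in> lmeasurable" using fmeasurable.Un[OF Nm(1) U(3)] UN by simp
    have "measure lebesgue U \<le> measure lebesgue N + measure lebesgue (U - N)"
      using measure_Un_le[of N lebesgue "U - N"] UN Nm U(3) by auto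
    also have "\<dots> < \<delta>"
      using U(3,4) Nm(2) \<delta>(1) by (simp add: emeasure_eq_measure2 ennreal_less_iff)
    finally have Ud: "measure lebesgue U < \<delta>" .
    have "\<exists>r>0. (t \<in> N \<longrightarrow> ball t r \<subseteq> U) \<and>
       (t \<in> {a..b} - N \<longrightarrow> (\<forall>y\<in>{a..b}. \<bar>y - t\<bar> < r \<longrightarrow> \<bar>f y - f t - g t * (y - t)\<bar> \<le> e1 * \<bar>y - t\<bar>))" for t
    proof (cases "t \<in> N")
      case True
      then show ?thesis using U(1,2) by (metis DiffD2 open_contains_ball subsetD)
    next
      case False
      show ?thesis
      proof (cases "t \<in> {a..b}")
        case True
        have "(f has_derivative (\<lambda>h. g t * h)) (at t within {a..b})"
          using deriv[of t] True False by (simp add: has_field_derivative_def)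
        then obtain r where "r > 0" "\<forall>y\<in>{a..b}. norm (y - t) < r \<longrightarrow> norm (f y - f t - g t * (y - t)) \<le> e1 * norm (y - t)"
          using e1 unfolding has_derivative_within_alt by blast
        then show ?thesis using False by auto
      next
        case False
        then show ?thesis using \<open>t \<notin> N\<close> by (intro exI[of _ 1]) auto
      qed
    qed
    then obtain r where r: "\<And>t. r t > 0" "\<And>t. t \<in> N \<Longrightarrow> ball t (r t) \<subseteq> U"
       "\<And>t y. t \<in> {a..b} - N \<Longrightarrow> y \<in> {a..b} \<Longrightarrow> \<bar>y - t\<bar> < r t \<Longrightarrow> \<bar>f y - f t - g t * (y - t)\<bar> \<le> e1 * \<bar>y - t\<bar>"
      by metis
    define \<gamma> where "\<gamma> = (\<lambda>t. ball t (r t))"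
    show "\<exists>\<gamma>. gauge \<gamma> \<and> (\<forall>\<D>. \<D> tagged_division_of {a..b} \<and> \<gamma> fine \<D> \<longrightarrow>
        norm ((\<Sum>(x, k)\<in>\<D>. measure lborel k *\<^sub>R g0 x) - (f b - f a)) < e)"
    proof (intro exI[of _ \<gamma>] conjI allI impI)
      show "gauge \<gamma>" using r(1) by (auto simp: gauge_def \<gamma>_def)
      fix p assume "p tagged_division_of {a..b} \<and> \<gamma> fine p"
      then have p: "p tagged_division_of {a..b}" "\<gamma> fine p" by auto
      note fin = tagged_division_of_finite[OF p(1)]
      have K: "k = {Inf k..Sup k} \<and> Inf k \<le> x \<and> x \<le> Sup k \<and> a \<le> Inf k \<and> Sup k \<le> b \<and> k \<subseteq> ball x (r x)
          \<and> measure lborel k = Sup k - Inf k"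
        if xk: "(x, k) \<in> p" for x k
      proof -
        obtain u v where uv: "k = {u..v}" using tagged_division_ofD(4)[OF p(1) xk] by (metis box_real(2))
        moreover have "x \<in> k" "k \<subseteq> {a..b}" using tagged_division_ofD(2,3)[OF p(1) xk] by auto
        moreover have "k \<subseteq> ball x (r x)" using p(2) xk by (auto simp: fine_def \<gamma>_def)
        ultimately show ?thesis by auto
      qed
      define B where "B = {xk \<in> p. fst xk \<in> N}"
      have Bp: "B \<subseteq> p" by (auto simp: B_def)
      have Bt: "B tagged_partial_division_of {a..b}"
        using tagged_partial_division_subset[OF _ Bp] p(1) tagged_division_of_def by blast
      have Bd: "snd ` B division_of \<Union>(snd ` B)"
        using division_of_tagged_division[OF tagged_partial_division_of_Union_self[OF Bt]] .
      have Bsub: "\<Union>(snd ` B) \<subseteq> U" using K r(2) by (fastforce simp: B_def)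
      have "(\<Sum>k\<in>snd ` B. Sup k - Inf k) = (\<Sum>k\<in>snd ` B. measure lborel k)"
        by (rule sum.cong) (use K in \<open>auto simp: B_def\<close>)
      also have "\<dots> = measure lebesgue (\<Union>(snd ` B))"
        unfolding content_division[OF Bd, symmetric]
      proof (rule sum.cong)
        fix k assume "k \<in> snd ` B"
        then have "k = {Inf k..Sup k}" using K by (auto simp: B_def)
        then have "k \<in> sets lborel" by (metis atLeastAtMost_borel sets_lborel)
        then show "measure lborel k = measure lebesgue k" by simp
      qed simp
      also have "\<dots> \<le> measure lebesgue U"
        using measure_mono_fmeasurable[OF Bsub _ Um] lmeasurable_division[OF Bd] by auto
      finally have small: "(\<Sum>k\<in>snd ` B. Sup k - Inf k) < \<delta>" using Ud by simp
      have "\<Union>(snd ` B) \<subseteq> {a..b}" using tagged_partial_division_ofD(3)[OF Bt] by fastforce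
      then have bad: "(\<Sum>k\<in>snd ` B. \<bar>f (Sup k) - f (Inf k)\<bar>) < e / 2"
        using \<delta>(2) Bd small by blast
      \<comment> \<open>\<open>Sup\<close> and \<open>Inf\<close> of the empty interval are unrelated default values, hence the case distinction.\<close>
      define D where "D = (\<lambda>k. if k = {} then 0 else \<bar>f (Sup k) - f (Inf k)\<bar>)"
      have D: "D k = \<bar>f (Sup k) - f (Inf k)\<bar>" if "(x, k) \<in> p" for x k
        using tagged_division_ofD(2)[OF p(1) that] by (auto simp: D_def)
      have "(\<Sum>(x,k)\<in>B. D k) = (\<Sum>k\<in>snd ` B. D k)"
      proof (rule sum.over_tagged_division_lemma[OF tagged_partial_division_of_Union_self[OF Bt]])
        fix u v :: real assume "box u v = {}"
        then have "v \<le> u" by simp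
        then show "D (cbox u v) = 0" by (cases "v = u") (auto simp: D_def)
      qed
      moreover have "(\<Sum>k\<in>snd ` B. D k) = (\<Sum>k\<in>snd ` B. \<bar>f (Sup k) - f (Inf k)\<bar>)"
        by (rule sum.cong) (use D Bp in auto)
      moreover have "(\<Sum>(x,k)\<in>B. D k) = (\<Sum>(x,k)\<in>B. \<bar>f (Sup k) - f (Inf k)\<bar>)"
        by (rule sum.cong) (use D Bp in auto)
      ultimately have "(\<Sum>k\<in>snd ` B. \<bar>f (Sup k) - f (Inf k)\<bar>) = (\<Sum>(x,k)\<in>B. \<bar>f (Sup k) - f (Inf k)\<bar>)"
        by simp
      with bad have bad': "(\<Sum>(x,k)\<in>B. \<bar>f (Sup k) - f (Inf k)\<bar>) < e / 2" by simp
      have "(\<Sum>(x, k)\<in>p. measure lborel k *\<^sub>R g0 x) - (f b - f a)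
          = (\<Sum>(x, k)\<in>p. measure lborel k *\<^sub>R g0 x - (f (Sup k) - f (Inf k)))"
        using additive_tagged_division_1[OF ab p(1), of f] by (simp add: sum_subtractf split_def)
      also have "norm \<dots> \<le> (\<Sum>(x, k)\<in>p. norm (measure lborel k *\<^sub>R g0 x - (f (Sup k) - f (Inf k))))"
        by (rule order_trans[OF norm_sum]) (simp add: split_def)
      also have "\<dots> \<le> (\<Sum>(x, k)\<in>p. e1 * measure lborel k + (if x \<in> N then \<bar>f (Sup k) - f (Inf k)\<bar> else 0))"
      proof (rule sum_mono, clarify)
        fix x k assume xk: "(x, k) \<in> p"
        note Kx = K[OF xk]
        then have ck: "measure lborel k = Sup k - Inf k" by blast
        show "norm (measure lborel k *\<^sub>R g0 x - (f (Sup k) - f (Inf k))) \<le>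
           e1 * measure lborel k + (if x \<in> N then \<bar>f (Sup k) - f (Inf k)\<bar> else 0)"
        proof (cases "x \<in> N")
          case True
          have "e1 * measure lborel k \<ge> 0" using e1 by simp
          then show ?thesis using True by (simp add: g0_def abs_minus_commute)
        next
          case False
          have "Sup k \<in> k" "Inf k \<in> k" using Kx by (metis atLeastAtMost_iff order.trans order_refl)+
          then have near: "\<bar>Sup k - x\<bar> < r x" "\<bar>Inf k - x\<bar> < r x" using Kx by (auto simp: dist_real_def)
          have "\<bar>f (Sup k) - f x - g x * (Sup k - x)\<bar> \<le> e1 * \<bar>Sup k - x\<bar>"
            "\<bar>f (Inf k) - f x - g x * (Inf k - x)\<bar> \<le> e1 * \<bar>Inf k - x\<bar>"
            by (rule r(3); use near Kx False in force)+
          then have "\<bar>(f (Sup k) - f x - g x * (Sup k - x)) - (f (Inf k) - f x - g x * (Inf k - x))\<bar>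
             \<le> e1 * \<bar>Sup k - x\<bar> + e1 * \<bar>Inf k - x\<bar>" by linarith
          also have "\<bar>Sup k - x\<bar> = Sup k - x" using Kx by auto
          also have "\<bar>Inf k - x\<bar> = x - Inf k" using Kx by auto
          also have "e1 * (Sup k - x) + e1 * (x - Inf k) = e1 * measure lborel k" unfolding ck by (simp add: algebra_simps)
          also have "(f (Sup k) - f x - g x * (Sup k - x)) - (f (Inf k) - f x - g x * (Inf k - x))
             = (f (Sup k) - f (Inf k)) - measure lborel k * g x" unfolding ck by (simp add: algebra_simps)
          finally show ?thesis using False by (simp add: g0_def abs_minus_commute)
        qed
      qed
      also have "\<dots> = e1 * (\<Sum>(x, k)\<in>p. measure lborel k) + (\<Sum>(x,k)\<in>B. \<bar>f (Sup k) - f (Inf k)\<bar>)"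
      proof -
        have "(\<Sum>(x,k)\<in>B. \<bar>f (Sup k) - f (Inf k)\<bar>) = (\<Sum>(x,k)\<in>p. if x \<in> N then \<bar>f (Sup k) - f (Inf k)\<bar> else 0)"
          unfolding B_def by (subst sum.inter_filter[OF fin]) (auto simp: split_def intro!: sum.cong)
        then show ?thesis by (simp add: sum.distrib split_def sum_distrib_left)
      qed
      also have "(\<Sum>(x, k)\<in>p. measure lborel k) = b - a"
        using additive_content_tagged_division[of p a b] p(1) ab by simp
      also have "e1 * (b - a) + (\<Sum>(x,k)\<in>B. \<bar>f (Sup k) - f (Inf k)\<bar>) < e / 2 + e / 2"
      proof (rule add_le_less_mono[OF _ bad'])
        have "e1 * (b - a) \<le> e1 * (b - a + 1)" using e1 by (intro mult_left_mono) auto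
        also have "\<dots> = e / 2" using ab by (simp add: e1_def field_simps)
        finally show "e1 * (b - a) \<le> e / 2" .
      qed
      finally show "norm ((\<Sum>(x, k)\<in>p. measure lborel k *\<^sub>R g0 x) - (f b - f a)) < e" by simp
    qed
  qed
  then show ?thesis
    by (rule has_integral_spike[OF N, rotated]) (auto simp: g0_def)
qed

section \<open>The regularised first order system\<close>

text \<open>The quasi-derivative \<open>w = u' + \<sigma> u\<close> absorbs the singular part of the potential \<open>\<sigma>' + m\<close>; here \<open>\<kappa> = \<lambda> + m\<close>.\<close>

definition reg_system :: "real \<Rightarrow> (real \<Rightarrow> real) \<Rightarrow> real \<Rightarrow> (real \<Rightarrow> real) \<Rightarrow> (real \<Rightarrow> real) \<Rightarrow> bool" where
  "reg_system S \<sigma> \<kappa> u w \<longleftrightarrow> (\<forall>t\<in>{0..S}.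
     (u has_real_derivative w t - \<sigma> t * u t) (at t within {0..S}) \<and>
     (w has_real_derivative \<sigma> t * w t - (\<kappa> + (\<sigma> t)\<^sup>2) * u t) (at t within {0..S}))"

lemma reg_systemD:
  assumes "reg_system S \<sigma> \<kappa> u w" "t \<in> {0..S}"
  shows "(u has_real_derivative w t - \<sigma> t * u t) (at t within {0..S})"
    "(w has_real_derivative \<sigma> t * w t - (\<kappa> + (\<sigma> t)\<^sup>2) * u t) (at t within {0..S})"
  using assms by (auto simp: reg_system_def)

lemma reg_system_continuous:
  assumes "reg_system S \<sigma> \<kappa> u w"
  shows "continuous_on {0..S} u" "continuous_on {0..S} w"
  by (rule DERIV_continuous_on, erule reg_systemD[OF assms])+

lemma AE_lebesgue_on_negligible:
  "(AE t in lebesgue_on {a..b::real}. P t) \<longleftrightarrow> (\<exists>N. negligible N \<and> (\<forall>t\<in>{a..b} - N. P t))"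
proof -
  have "(AE t in lebesgue_on {a..b}. P t) \<longleftrightarrow> (AE t in lebesgue. t \<in> {a..b} \<longrightarrow> P t)"
    by (rule AE_restrict_space_iff) auto
  also have "\<dots> \<longleftrightarrow> (\<exists>N. negligible N \<and> (\<forall>t\<in>{a..b} - N. P t))"
  proof
    assume "AE t in lebesgue. t \<in> {a..b} \<longrightarrow> P t"
    then obtain N where "N \<in> null_sets lebesgue" "{t. \<not> (t \<in> {a..b} \<longrightarrow> P t)} \<subseteq> N"
      by (auto simp: eventually_ae_filter)
    then show "\<exists>N. negligible N \<and> (\<forall>t\<in>{a..b} - N. P t)"
      by (intro exI[of _ N]) (auto simp: negligible_iff_null_sets)
  next
    assume "\<exists>N. negligible N \<and> (\<forall>t\<in>{a..b} - N. P t)"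
    then obtain N where "N \<in> null_sets lebesgue" "\<forall>t\<in>{a..b} - N. P t"
      by (auto simp: negligible_iff_null_sets)
    then show "AE t in lebesgue. t \<in> {a..b} \<longrightarrow> P t"
      by (intro AE_I'[of N]) auto
  qed
  finally show ?thesis .
qed

lemma continuous_on_interval_bound:
  fixes f :: "real \<Rightarrow> real"
  assumes "continuous_on {a..b} f"
  obtains C where "\<And>t. t \<in> {a..b} \<Longrightarrow> \<bar>f t\<bar> \<le> C"
proof -
  have "bounded (f ` {a..b})" using assms by (intro compact_imp_bounded compact_continuous_image) auto
  then obtain C where "\<forall>y\<in>f ` {a..b}. norm y \<le> C" by (auto simp: bounded_iff)
  then show ?thesis by (intro that[of C]) simp
qed

lemma abs_continuous_on_mult_continuous:
  assumes "abs_continuous_on {a..b} f" "abs_continuous_on {a..b} g"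
    "continuous_on {a..b} f" "continuous_on {a..b} g"
  shows "abs_continuous_on {a..b} (\<lambda>x. f x * g x)"
proof -
  obtain C where C: "\<And>t. t \<in> {a..b} \<Longrightarrow> \<bar>f t\<bar> \<le> C" using continuous_on_interval_bound[OF assms(3)] by blast
  obtain D where D: "\<And>t. t \<in> {a..b} \<Longrightarrow> \<bar>g t\<bar> \<le> D" using continuous_on_interval_bound[OF assms(4)] by blast
  show ?thesis
    by (rule abs_continuous_on_mult[OF assms(1,2), where C = "max C D"]) (use C D in \<open>auto simp: le_max_iff_disj\<close>)
qed

lemma primitive_props:
  fixes q :: "real \<Rightarrow> real"
  assumes q: "q absolutely_integrable_on {0..S}" and \<sigma>: "\<sigma> = (\<lambda>t. integral {0..t} q - m * t)"
  shows "continuous_on {0..S} \<sigma>" "abs_continuous_on {0..S} \<sigma>"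
    and "\<exists>N. negligible N \<and> (\<forall>t\<in>{0..S} - N. (\<sigma> has_real_derivative q t - m) (at t within {0..S}))"
proof -
  have qi: "q integrable_on {0..S}" using q set_lebesgue_integral_eq_integral(1) by blast
  show "continuous_on {0..S} \<sigma>" unfolding \<sigma>
    by (intro continuous_intros indefinite_integral_continuous_1 qi)
  show "abs_continuous_on {0..S} \<sigma>" unfolding \<sigma>
    by (intro abs_continuous_on_diff abs_continuous_on_integral q
        abs_continuous_on_lipschitz[where C = "\<bar>m\<bar>"]) (simp add: abs_mult flip: right_diff_distrib)
  obtain N where "negligible N"
    "\<And>t. t \<in> {0..S} - N \<Longrightarrow> ((\<lambda>t. integral {0..t} q) has_real_derivative q t) (at t within {0..S})"
    using integral_has_derivative_AE[OF qi] by blast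
  then show "\<exists>N. negligible N \<and> (\<forall>t\<in>{0..S} - N. (\<sigma> has_real_derivative q t - m) (at t within {0..S}))"
    unfolding \<sigma> by (intro exI[of _ N]) (auto intro!: derivative_eq_intros)
qed

text \<open>In \<open>w' = v' + \<sigma>' u + \<sigma> v\<close> the terms with \<open>q\<close> cancel almost everywhere, leaving a continuous function \<open>h\<close>. As \<open>w\<close> is absolutely continuous, it is the integral of \<open>h\<close>, hence differentiable at every point. Conversely, \<open>v = w - \<sigma> u\<close> inherits absolute continuity from \<open>\<sigma>\<close>.\<close>

lemma is_solution_iff_reg_system:
  fixes q :: "real \<Rightarrow> real"
  assumes q: "q absolutely_integrable_on {0..S}" and \<sigma>: "\<sigma> = (\<lambda>t. integral {0..t} q - m * t)"
    and w: "\<And>t. w t = v t + \<sigma> t * u t"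
  shows "is_solution S q l u v \<longleftrightarrow> reg_system S \<sigma> (l + m) u w"
proof -
  note \<sigma>c = primitive_props(1)[OF q \<sigma>] and \<sigma>ac = primitive_props(2)[OF q \<sigma>]
  obtain N where N: "negligible N" 
    "\<And>t. t \<in> {0..S} - N \<Longrightarrow> (\<sigma> has_real_derivative q t - m) (at t within {0..S})"
    using primitive_props(3)[OF q \<sigma>] by blast
  have v: "v = (\<lambda>t. w t - \<sigma> t * u t)" using w by auto
  define h where "h = (\<lambda>t. \<sigma> t * w t - (l + m + (\<sigma> t)\<^sup>2) * u t)"
  show ?thesis
  proof
    assume sol: "is_solution S q l u v"
    have du: "(u has_real_derivative v t) (at t within {0..S})" if "t \<in> {0..S}" for t
      using sol that by (auto simp: is_solution_def)
    have vc: "continuous_on {0..S} v" and vac: "abs_continuous_on {0..S} v"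
      using sol by (auto simp: is_solution_def)
    have uc: "continuous_on {0..S} u" using du by (rule DERIV_continuous_on)
    have uac: "abs_continuous_on {0..S} u" using abs_continuous_on_C1[OF du vc] .
    have w_eq: "w = (\<lambda>t. v t + \<sigma> t * u t)" using w by auto
    have wc: "continuous_on {0..S} w" unfolding w_eq by (intro continuous_intros vc \<sigma>c uc)
    have wac: "abs_continuous_on {0..S} w" unfolding w_eq
      by (intro abs_continuous_on_add vac abs_continuous_on_mult_continuous \<sigma>ac uac \<sigma>c uc)
    have hc: "continuous_on {0..S} h" unfolding h_def by (intro continuous_intros wc \<sigma>c uc)
    obtain N' where N': "negligible N'" "\<forall>t\<in>{0..S} - N'. \<exists>y. (v has_real_derivative y) (at t within {0..S}) \<and> y + (q t + l) * u t = 0"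
      using sol unfolding is_solution_def AE_lebesgue_on_negligible by blast
    have dw: "(w has_real_derivative h t) (at t within {0..S})" if t: "t \<in> {0..S} - (N \<union> N')" for t
    proof -
      obtain y where y: "(v has_real_derivative y) (at t within {0..S})" "y + (q t + l) * u t = 0"
        using N'(2) t by blast
      have \<sigma>': "(\<sigma> has_real_derivative q t - m) (at t within {0..S})" using N(2) t by blast
      have "(w has_real_derivative y + ((q t - m) * u t + v t * \<sigma> t)) (at t within {0..S})"
        unfolding w_eq by (intro DERIV_add DERIV_mult y(1) \<sigma>') (use du t in auto)
      moreover have "y + ((q t - m) * u t + v t * \<sigma> t) = h t"
        unfolding h_def v using y(2) by (simp add: algebra_simps power2_eq_square)
      ultimately show ?thesis by simp
    qed
    have w_int: "w t = w 0 + integral {0..t} h" if t: "t \<in> {0..S}" for t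
    proof -
      have sub: "{0..t} \<subseteq> {0..S}" using t by auto
      have "(h has_integral w t - w 0) {0..t}"
      proof (rule abs_continuous_on_FTC)
        show "abs_continuous_on {0..t} w" using abs_continuous_on_subset[OF wac sub] .
        show "negligible (N \<union> N')" using N(1) N'(1) by auto
        show "(w has_real_derivative h x) (at x within {0..t})" if "x \<in> {0..t} - (N \<union> N')" for x
          using dw[of x] that sub by (auto intro: DERIV_subset)
      qed (use t in auto)
      then show ?thesis by (simp add: integral_unique)
    qed
    have dw': "(w has_real_derivative h t) (at t within {0..S})" if t: "t \<in> {0..S}" for t
    proof -
      have "((\<lambda>t. w 0 + integral {0..t} h) has_real_derivative h t) (at t within {0..S})"
        using integral_has_real_derivative[OF hc t] by (auto intro!: derivative_eq_intros)
      then show ?thesis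
        by (rule has_field_derivative_transform_within[OF _ zero_less_one t]) (rule w_int[symmetric])
    qed
    show "reg_system S \<sigma> (l + m) u w"
      using dw' du unfolding reg_system_def h_def v by auto
  next
    assume sys: "reg_system S \<sigma> (l + m) u w"
    note D = reg_systemD[OF sys] and C = reg_system_continuous[OF sys]
    have du: "(u has_real_derivative v t) (at t within {0..S})" if "t \<in> {0..S}" for t
      using D(1)[OF that] by (simp add: w)
    have vc: "continuous_on {0..S} v" unfolding v by (intro continuous_intros C \<sigma>c)
    have hc: "continuous_on {0..S} h" unfolding h_def by (intro continuous_intros C \<sigma>c)
    have uac: "abs_continuous_on {0..S} u" using abs_continuous_on_C1[OF du vc] .
    have wac: "abs_continuous_on {0..S} w" using abs_continuous_on_C1[OF _ hc] D(2) unfolding h_def by blast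
    have vac: "abs_continuous_on {0..S} v" unfolding v
      by (intro abs_continuous_on_diff wac abs_continuous_on_mult_continuous \<sigma>ac uac \<sigma>c C)
    have "\<exists>y. (v has_real_derivative y) (at t within {0..S}) \<and> y + (q t + l) * u t = 0"
      if t: "t \<in> {0..S} - N" for t
    proof (intro exI conjI)
      show "(v has_real_derivative h t - ((q t - m) * u t + v t * \<sigma> t)) (at t within {0..S})"
        unfolding v by (intro DERIV_diff DERIV_mult N(2) t) (use D[of t] t in \<open>auto simp: h_def\<close>)
      show "h t - ((q t - m) * u t + v t * \<sigma> t) + (q t + l) * u t = 0"
        unfolding h_def v by (simp add: algebra_simps power2_eq_square)
    qed
    then show "is_solution S q l u v"
      unfolding is_solution_def AE_lebesgue_on_negligible using du vc vac N(1) by blast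
  qed
qed

lemma wronskian_derivative:
  assumes "reg_system S \<sigma> \<kappa> u w" "reg_system S \<sigma> \<mu> u' w'" "t \<in> {0..S}"
  shows "((\<lambda>t. u t * w' t - w t * u' t) has_real_derivative (\<kappa> - \<mu>) * (u t * u' t)) (at t within {0..S})"
  by (rule derivative_eq_intros reg_systemD[OF assms(1,3)] reg_systemD[OF assms(2,3)] refl)+
    (simp add: algebra_simps power2_eq_square)

lemma wronskian_const:
  assumes "reg_system S \<sigma> \<kappa> u w" "reg_system S \<sigma> \<kappa> u' w'" "t \<in> {0..S}"
  shows "u t * w' t - w t * u' t = u 0 * w' 0 - w 0 * u' 0"
proof -
  have "\<exists>c. \<forall>t\<in>{0..S}. u t * w' t - w t * u' t = c"
    using wronskian_derivative[OF assms(1,2)] by (intro has_field_derivative_zero_constant) auto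
  moreover have "0 \<in> {0..S}" using assms(3) by auto
  ultimately show ?thesis using assms(3) by metis
qed

lemma wronskian_integral:
  assumes "reg_system S \<sigma> \<kappa> u w" "reg_system S \<sigma> \<mu> u' w'" "S \<ge> 0"
  shows "(u S * w' S - w S * u' S) - (u 0 * w' 0 - w 0 * u' 0) = (\<kappa> - \<mu>) * integral {0..S} (\<lambda>t. u t * u' t)"
proof -
  have "((\<lambda>t. (\<kappa> - \<mu>) * (u t * u' t)) has_integral
     (u S * w' S - w S * u' S) - (u 0 * w' 0 - w 0 * u' 0)) {0..S}"
    by (rule fundamental_theorem_of_calculus[OF assms(3)])
      (use wronskian_derivative[OF assms(1,2)] in \<open>auto simp: has_real_derivative_iff_has_vector_derivative\<close>)
  then show ?thesis by (auto dest!: integral_unique)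
qed

text \<open>Cramer's rule: the coefficients of \<open>u\<close> with respect to the basis \<open>c\<close>, \<open>s\<close> are Wronskians, hence constant. Uniqueness of solutions of the initial value problem is a consequence.\<close>

lemma reg_system_decompose:
  assumes c: "reg_system S \<sigma> \<kappa> c c'" "c 0 = 1" "c' 0 = 0"
    and s: "reg_system S \<sigma> \<kappa> s s'" "s 0 = 0" "s' 0 = 1"
    and u: "reg_system S \<sigma> \<kappa> u w" and t: "t \<in> {0..S}"
  shows "u t = u 0 * c t + w 0 * s t" "w t = u 0 * c' t + w 0 * s' t"
proof -
  have W: "c t * s' t - c' t * s t = 1" using wronskian_const[OF c(1) s(1) t] c s by simp
  have cu: "c t * w t - c' t * u t = w 0" using wronskian_const[OF c(1) u t] c by simp
  have us: "u t * s' t - w t * s t = u 0" using wronskian_const[OF u s(1) t] s by simp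
  show "u t = u 0 * c t + w 0 * s t" "w t = u 0 * c' t + w 0 * s' t"
    using W unfolding cu[symmetric] us[symmetric] by algebra+
qed

lemma reg_system_comb:
  assumes "reg_system S \<sigma> \<kappa> u w" "reg_system S \<sigma> \<kappa> u' w'"
  shows "reg_system S \<sigma> \<kappa> (\<lambda>t. x * u t + y * u' t) (\<lambda>t. x * w t + y * w' t)"
  unfolding reg_system_def
proof (intro ballI conjI)
  fix t assume t: "t \<in> {0..S}"
  show "((\<lambda>t. x * u t + y * u' t) has_real_derivative (x * w t + y * w' t) - \<sigma> t * (x * u t + y * u' t)) (at t within {0..S})"
    by (rule derivative_eq_intros reg_systemD[OF assms(1) t] reg_systemD[OF assms(2) t] refl)+ (simp add: algebra_simps)
  show "((\<lambda>t. x * w t + y * w' t) has_real_derivative \<sigma> t * (x * w t + y * w' t) - (\<kappa> + (\<sigma> t)\<^sup>2) * (x * u t + y * u' t)) (at t within {0..S})"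
    by (rule derivative_eq_intros reg_systemD[OF assms(1) t] reg_systemD[OF assms(2) t] refl)+ (simp add: algebra_simps)
qed

lemma reg_system_trivial:
  assumes sys: "reg_system S \<sigma> \<kappa> u w" and S: "S > 0" and u0: "\<And>t. t \<in> {0..S} \<Longrightarrow> u t = 0"
  shows "w 0 = 0"
proof -
  have mem: "0 \<in> {0..S}" using S by auto
  have "(u has_real_derivative 0) (at 0 within {0..S})"
    by (rule has_field_derivative_transform_within[OF DERIV_const zero_less_one mem]) (simp add: u0)
  moreover have "(u has_real_derivative w 0 - \<sigma> 0 * u 0) (at 0 within {0..S})"
    by (rule reg_systemD(1)[OF sys mem])
  ultimately have "w 0 - \<sigma> 0 * u 0 = 0"
    unfolding has_real_derivative_iff_has_vector_derivative
    using vector_derivative_unique_within_closed_interval[of 0 S 0] S by fastforce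
  then show "w 0 = 0" using u0[OF mem] by simp
qed

section \<open>Existence and continuous dependence on the parameter\<close>

lemma continuous_on_slice:
  fixes f :: "real \<Rightarrow> real \<Rightarrow> 'b::topological_space"
  assumes "continuous_on (A \<times> UNIV) (\<lambda>(t, \<kappa>). f t \<kappa>)"
  shows "continuous_on A (\<lambda>t. f t \<kappa>)"
proof -
  have "continuous_on A (\<lambda>t. case (t, \<kappa>) of (t, \<kappa>) \<Rightarrow> f t \<kappa>)"
    by (rule continuous_on_compose2[OF assms]) (auto intro!: continuous_intros)
  then show ?thesis by simp
qed

text \<open>Substituting \<open>s = t x\<close> makes the domain of integration independent of \<open>t\<close>.\<close>

lemma continuous_on_param_integral_upto:
  fixes f :: "real \<Rightarrow> real \<Rightarrow> complex"
  assumes f: "continuous_on ({0..S} \<times> UNIV) (\<lambda>(t, \<kappa>). f t \<kappa>)"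
  shows "continuous_on ({0..S} \<times> UNIV) (\<lambda>(t, \<kappa>). integral {0..t} (\<lambda>s. f s \<kappa>))"
proof -
  have eq: "integral {0..t} (\<lambda>s. f s \<kappa>) = t *\<^sub>R integral {0..1} (\<lambda>s. f (t * s) \<kappa>)" if "t \<ge> 0" for t \<kappa>
  proof (cases "t = 0")
    case False
    then have "(\<lambda>x. x / t) ` {0..t} = {0..1}" using that by (simp add: image_divide_atLeastAtMost)
    then show ?thesis using integral_stretch_real[of t 0 t "\<lambda>s. f s \<kappa>"] False that by simp
  qed simp
  have "continuous_on (({0..S} \<times> UNIV) \<times> cbox 0 1) (\<lambda>x. (fst (fst x) * snd x, snd (fst x)))"
    by (intro continuous_intros)
  moreover have "(\<lambda>x. (fst (fst x) * snd x, snd (fst x))) ` (({0..S} \<times> UNIV) \<times> cbox 0 1) \<subseteq> {0..S} \<times> (UNIV :: real set)"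
    by (auto intro: order_trans[OF mult_left_le])
  ultimately have "continuous_on (({0..S} \<times> UNIV) \<times> cbox 0 1) (\<lambda>x. case (fst (fst x) * snd x, snd (fst x)) of (t, \<kappa>) \<Rightarrow> f t \<kappa>)"
    by (rule continuous_on_compose2[OF f])
  then have "continuous_on (({0..S} \<times> UNIV) \<times> cbox 0 1) (\<lambda>(x, s). f (fst x * s) (snd x))"
    by (simp add: split_def)
  then have "continuous_on ({0..S} \<times> UNIV) (\<lambda>x. integral (cbox 0 1) (\<lambda>s. f (fst x * s) (snd x)))"
    by (rule integral_continuous_on_param)
  then have "continuous_on ({0..S} \<times> UNIV) (\<lambda>x. fst x *\<^sub>R integral {0..1} (\<lambda>s. f (fst x * s) (snd x)))"
    by (intro continuous_intros) simp
  then show ?thesis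
    by (rule continuous_on_eq) (auto simp: eq)
qed

context
  fixes \<alpha> \<beta> :: "real \<Rightarrow> real \<Rightarrow> complex" and z0 :: complex
begin

text \<open>An arbitrary real linear map of \<open>\<complex>\<close> has the form \<open>z \<mapsto> \<alpha> z + \<beta> (cnj z)\<close>. With \<open>z = w + \<i> u\<close> the regularised system is therefore one equation of this kind. The sequence below consists of the increments of the Picard iteration, so the solution is its sum.\<close>

primrec picard :: "nat \<Rightarrow> real \<Rightarrow> real \<Rightarrow> complex" where
  "picard 0 = (\<lambda>t \<kappa>. z0)"
| "picard (Suc n) = (\<lambda>t \<kappa>. integral {0..t} (\<lambda>s. \<alpha> s \<kappa> * picard n s \<kappa> + \<beta> s \<kappa> * cnj (picard n s \<kappa>)))"

definition picard_limit :: "real \<Rightarrow> real \<Rightarrow> complex" where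
  "picard_limit t \<kappa> = (\<Sum>n. picard n t \<kappa>)"

context
  fixes S :: real
  assumes \<alpha>: "continuous_on ({0..S} \<times> UNIV) (\<lambda>(t, \<kappa>). \<alpha> t \<kappa>)"
    and \<beta>: "continuous_on ({0..S} \<times> UNIV) (\<lambda>(t, \<kappa>). \<beta> t \<kappa>)"
begin

lemma continuous_on_linear_rhs:
  assumes "continuous_on ({0..S} \<times> UNIV) (\<lambda>(t, \<kappa>). f t \<kappa>)"
  shows "continuous_on ({0..S} \<times> UNIV) (\<lambda>(t, \<kappa>). \<alpha> t \<kappa> * f t \<kappa> + \<beta> t \<kappa> * cnj (f t \<kappa>))"
  using assms \<alpha> \<beta> unfolding split_def by (intro continuous_intros)

lemma continuous_on_picard: "continuous_on ({0..S} \<times> UNIV) (\<lambda>(t, \<kappa>). picard n t \<kappa>)"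
proof (induction n)
  case (Suc n)
  show ?case
    unfolding picard.simps by (rule continuous_on_param_integral_upto[OF continuous_on_linear_rhs[OF Suc]])
qed (simp add: split_def)

lemma coefficient_bound:
  obtains K where "K \<ge> 0" "\<And>t \<kappa>. t \<in> {0..S} \<Longrightarrow> \<bar>\<kappa>\<bar> \<le> R \<Longrightarrow> norm (\<alpha> t \<kappa>) + norm (\<beta> t \<kappa>) \<le> K"
proof -
  have "continuous_on ({0..S} \<times> {-R..R}) (\<lambda>(t, \<kappa>). norm (\<alpha> t \<kappa>) + norm (\<beta> t \<kappa>))"
    using \<alpha> \<beta> unfolding split_def by (intro continuous_intros; elim continuous_on_subset; auto)
  then have "bounded ((\<lambda>(t, \<kappa>). norm (\<alpha> t \<kappa>) + norm (\<beta> t \<kappa>)) ` ({0..S} \<times> {-R..R}))"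
    by (intro compact_imp_bounded compact_continuous_image compact_Times) auto
  then obtain K where K: "\<forall>y\<in>(\<lambda>(t, \<kappa>). norm (\<alpha> t \<kappa>) + norm (\<beta> t \<kappa>)) ` ({0..S} \<times> {-R..R}). norm y \<le> K"
    by (auto simp: bounded_iff)
  show ?thesis
  proof (rule that[of "max K 0"])
    fix t \<kappa> :: real assume "t \<in> {0..S}" "\<bar>\<kappa>\<bar> \<le> R"
    then have "(t, \<kappa>) \<in> {0..S} \<times> {-R..R}" by auto
    from K[rule_format, OF imageI[OF this]] show "norm (\<alpha> t \<kappa>) + norm (\<beta> t \<kappa>) \<le> max K 0" by auto
  qed simp
qed

lemma norm_linear_rhs_le:
  assumes "norm (\<alpha> s \<kappa>) + norm (\<beta> s \<kappa>) \<le> K"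
  shows "norm (\<alpha> s \<kappa> * z + \<beta> s \<kappa> * cnj z) \<le> K * norm z"
proof -
  have "norm (\<alpha> s \<kappa> * z + \<beta> s \<kappa> * cnj z) \<le> norm (\<alpha> s \<kappa>) * norm z + norm (\<beta> s \<kappa>) * norm z"
    by (rule order_trans[OF norm_triangle_ineq]) (simp add: norm_mult)
  also have "\<dots> = (norm (\<alpha> s \<kappa>) + norm (\<beta> s \<kappa>)) * norm z" by (simp add: algebra_simps)
  also have "\<dots> \<le> K * norm z" using assms by (intro mult_right_mono) auto
  finally show ?thesis .
qed

lemma norm_picard_le:
  assumes K: "K \<ge> 0" "\<And>t. t \<in> {0..S} \<Longrightarrow> norm (\<alpha> t \<kappa>) + norm (\<beta> t \<kappa>) \<le> K" and t: "t \<in> {0..S}"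
  shows "norm (picard n t \<kappa>) \<le> norm z0 * (K * t) ^ n / fact n"
  using t
proof (induction n arbitrary: t)
  case (Suc n)
  have sub: "{0..t} \<subseteq> {0..S}" using Suc.prems by auto
  have "((\<lambda>s. K * (norm z0 * (K * s) ^ n / fact n)) has_integral
     (norm z0 * (K * t) ^ Suc n / fact (Suc n) - norm z0 * (K * 0) ^ Suc n / fact (Suc n))) {0..t}"
  proof (rule fundamental_theorem_of_calculus)
    fix s
    have D: "((\<lambda>s. norm z0 * (K * s) ^ Suc n / fact (Suc n)) has_real_derivative
       norm z0 * (real (Suc n) * (K * s) ^ n * K) / fact (Suc n)) (at s within {0..t})"
      by (rule derivative_eq_intros refl | simp)+
    have eq: "norm z0 * (real (Suc n) * (K * s) ^ n * K) / fact (Suc n) = K * (norm z0 * (K * s) ^ n / fact n)"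
      by (simp add: divide_simps del: of_nat_Suc)
    show "((\<lambda>s. norm z0 * (K * s) ^ Suc n / fact (Suc n)) has_vector_derivative
       K * (norm z0 * (K * s) ^ n / fact n)) (at s within {0..t})"
      by (rule D[unfolded eq has_real_derivative_iff_has_vector_derivative])
  qed (use Suc.prems in auto)
  then have I: "((\<lambda>s. K * (norm z0 * (K * s) ^ n / fact n)) has_integral norm z0 * (K * t) ^ Suc n / fact (Suc n)) {0..t}"
    by simp
  have "norm (picard (Suc n) t \<kappa>) \<le> integral {0..t} (\<lambda>s. K * (norm z0 * (K * s) ^ n / fact n))"
    unfolding picard.simps
  proof (rule integral_norm_bound_integral)
    show "(\<lambda>s. \<alpha> s \<kappa> * picard n s \<kappa> + \<beta> s \<kappa> * cnj (picard n s \<kappa>)) integrable_on {0..t}"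
      by (intro integrable_continuous_real continuous_on_subset[OF _ sub]
          continuous_on_slice[OF continuous_on_linear_rhs[OF continuous_on_picard]])
    fix s assume "s \<in> {0..t}"
    then have s: "s \<in> {0..S}" using sub by auto
    show "norm (\<alpha> s \<kappa> * picard n s \<kappa> + \<beta> s \<kappa> * cnj (picard n s \<kappa>)) \<le> K * (norm z0 * (K * s) ^ n / fact n)"
      by (rule order_trans[OF norm_linear_rhs_le[OF K(2)[OF s]] mult_left_mono[OF Suc.IH[OF s] K(1)]])
  qed (use I in blast)
  then show ?case using integral_unique[OF I] by simp
qed simp

lemma norm_picard_le_uniform:
  assumes "K \<ge> 0" "\<And>t. t \<in> {0..S} \<Longrightarrow> norm (\<alpha> t \<kappa>) + norm (\<beta> t \<kappa>) \<le> K" "t \<in> {0..S}"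
  shows "norm (picard n t \<kappa>) \<le> norm z0 * ((K * S) ^ n / fact n)"
proof -
  have "norm z0 * (K * t) ^ n / fact n \<le> norm z0 * (K * S) ^ n / fact n"
    using assms by (intro divide_right_mono mult_left_mono power_mono) auto
  then show ?thesis using norm_picard_le[OF assms, of n] by simp
qed

lemma summable_picard_majorant: "summable (\<lambda>n. norm z0 * ((K * S) ^ n / fact n))"
  using summable_exp[of "K * S"] by (intro summable_mult) (simp add: divide_inverse mult.commute)

lemma picard_sums:
  assumes "t \<in> {0..S}" shows "(\<lambda>n. picard n t \<kappa>) sums picard_limit t \<kappa>"
proof -
  obtain K where K: "K \<ge> 0" "\<And>t k. t \<in> {0..S} \<Longrightarrow> \<bar>k\<bar> \<le> \<bar>\<kappa>\<bar> \<Longrightarrow> norm (\<alpha> t k) + norm (\<beta> t k) \<le> K"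
    using coefficient_bound[of "\<bar>\<kappa>\<bar>"] by blast
  have "summable (\<lambda>n. picard n t \<kappa>)"
    by (rule summable_comparison_test'[OF summable_picard_majorant, of 0])
      (rule norm_picard_le_uniform[OF K(1) K(2) assms], auto)
  then show ?thesis unfolding picard_limit_def by (rule summable_sums)
qed

text \<open>The increments are majorised by the terms of an exponential series, uniformly for \<open>\<kappa>\<close> in a bounded interval.\<close>

lemma continuous_on_picard_limit: "continuous_on ({0..S} \<times> UNIV) (\<lambda>(t, \<kappa>). picard_limit t \<kappa>)"
  unfolding continuous_on_eq_continuous_within
proof
  fix x :: "real \<times> real" assume x: "x \<in> {0..S} \<times> UNIV"
  define R where "R = \<bar>snd x\<bar> + 1"
  let ?D = "{0..S} \<times> {-R..R}"
  obtain K where K: "K \<ge> 0" "\<And>t k. t \<in> {0..S} \<Longrightarrow> \<bar>k\<bar> \<le> R \<Longrightarrow> norm (\<alpha> t k) + norm (\<beta> t k) \<le> K"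
    using coefficient_bound[of R] by blast
  have "uniform_limit ?D (\<lambda>N p. \<Sum>n<N. picard n (fst p) (snd p)) (\<lambda>p. \<Sum>n. picard n (fst p) (snd p)) sequentially"
    by (rule Weierstrass_m_test[OF _ summable_picard_majorant[of K]])
      (rule norm_picard_le_uniform, use K in auto)
  moreover have "continuous_on ?D (\<lambda>p. \<Sum>n<N. picard n (fst p) (snd p))" for N
    by (intro continuous_on_sum continuous_on_subset[OF continuous_on_picard[unfolded split_def]]) auto
  ultimately have "continuous_on ?D (\<lambda>p. picard_limit (fst p) (snd p))"
    unfolding picard_limit_def by (intro uniform_limit_theorem) (auto intro!: always_eventually)
  moreover have "x \<in> ?D" using x by (auto simp: R_def)
  ultimately have "continuous (at x within ?D) (\<lambda>p. picard_limit (fst p) (snd p))"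
    by (auto simp: continuous_on_eq_continuous_within)
  moreover have "at x within ?D = at x within ({0..S} \<times> UNIV)"
    by (rule at_within_nhd[of _ "UNIV \<times> {-R<..<R}"]) (use x in \<open>auto simp: R_def open_Times\<close>)
  ultimately show "continuous (at x within {0..S} \<times> UNIV) (\<lambda>(t, \<kappa>). picard_limit t \<kappa>)"
    by (simp add: split_def)
qed

lemma picard_limit_integral_equation:
  assumes t: "t \<in> {0..S}"
  shows "picard_limit t \<kappa> = z0 + integral {0..t} (\<lambda>s. \<alpha> s \<kappa> * picard_limit s \<kappa> + \<beta> s \<kappa> * cnj (picard_limit s \<kappa>))"
proof -
  have sub: "{0..t} \<subseteq> {0..S}" using t by auto
  obtain K where K: "K \<ge> 0" "\<And>t k. t \<in> {0..S} \<Longrightarrow> \<bar>k\<bar> \<le> \<bar>\<kappa>\<bar> \<Longrightarrow> norm (\<alpha> t k) + norm (\<beta> t k) \<le> K"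
    using coefficient_bound[of "\<bar>\<kappa>\<bar>"] by blast
  define P where "P = (\<lambda>N s. \<Sum>n<N. picard n s \<kappa>)"
  define A where "A = (\<lambda>f s. \<alpha> s \<kappa> * f s + \<beta> s \<kappa> * cnj (f s))"
  define M where "M = (\<Sum>n. norm z0 * ((K * S) ^ n / fact n))"
  have int: "A (\<lambda>s. picard n s \<kappa>) integrable_on {0..t}" for n
    unfolding A_def
    by (intro integrable_continuous_real continuous_on_subset[OF _ sub]
          continuous_on_slice[OF continuous_on_linear_rhs[OF continuous_on_picard]])
  have A_sum: "A (P N) = (\<lambda>s. \<Sum>n<N. A (\<lambda>s. picard n s \<kappa>) s)" for N
    by (auto simp: A_def P_def sum.distrib sum_distrib_left)
  have step: "P (Suc N) t = z0 + integral {0..t} (A (P N))" for N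
  proof -
    have "integral {0..t} (A (P N)) = (\<Sum>n<N. integral {0..t} (A (\<lambda>s. picard n s \<kappa>)))"
      unfolding A_sum by (rule integral_sum) (use int in auto)
    then show ?thesis unfolding P_def A_def by (simp only: sum.lessThan_Suc_shift picard.simps)
  qed
  have lim: "(\<lambda>N. P N s) \<longlonglongrightarrow> picard_limit s \<kappa>" if "s \<in> {0..S}" for s
    using picard_sums[OF that] unfolding P_def sums_def .
  have "(\<lambda>N. integral {0..t} (A (P N))) \<longlonglongrightarrow> integral {0..t} (A (\<lambda>s. picard_limit s \<kappa>))"
  proof (rule dominated_convergence(2)[where h = "\<lambda>_. K * M"])
    show "A (P N) integrable_on {0..t}" for N
      unfolding A_sum by (intro integrable_sum int) auto
    fix N s assume "s \<in> {0..t}"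
    then have s: "s \<in> {0..S}" using sub by auto
    have "norm (P N s) \<le> (\<Sum>n<N. norm z0 * ((K * S) ^ n / fact n))"
      unfolding P_def by (intro sum_norm_le norm_picard_le_uniform K s) auto
    also have "\<dots> \<le> M" unfolding M_def
      by (rule sum_le_suminf[OF summable_picard_majorant]) (use K t in auto)
    finally have "K * norm (P N s) \<le> K * M" using K(1) by (rule mult_left_mono)
    then show "norm (A (P N) s) \<le> K * M"
      unfolding A_def using norm_linear_rhs_le[OF K(2)[OF s, of \<kappa>]] order_trans by blast
  next
    fix s assume "s \<in> {0..t}"
    then show "(\<lambda>N. A (P N) s) \<longlonglongrightarrow> A (\<lambda>s. picard_limit s \<kappa>) s"
      unfolding A_def using sub by (intro tendsto_intros lim) auto
  qed auto
  then have "(\<lambda>N. P (Suc N) t) \<longlonglongrightarrow> z0 + integral {0..t} (A (\<lambda>s. picard_limit s \<kappa>))"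
    unfolding step by (intro tendsto_intros)
  moreover have "(\<lambda>N. P (Suc N) t) \<longlonglongrightarrow> picard_limit t \<kappa>" using lim[OF t] by (rule LIMSEQ_Suc)
  ultimately show ?thesis unfolding A_def by (rule LIMSEQ_unique[rotated])
qed

lemma picard_limit_derivative:
  assumes t: "t \<in> {0..S}"
  shows "((\<lambda>t. picard_limit t \<kappa>) has_vector_derivative
     \<alpha> t \<kappa> * picard_limit t \<kappa> + \<beta> t \<kappa> * cnj (picard_limit t \<kappa>)) (at t within {0..S})"
proof -
  have "((\<lambda>t. z0 + integral {0..t} (\<lambda>s. \<alpha> s \<kappa> * picard_limit s \<kappa> + \<beta> s \<kappa> * cnj (picard_limit s \<kappa>))) has_vector_derivative
     0 + (\<alpha> t \<kappa> * picard_limit t \<kappa> + \<beta> t \<kappa> * cnj (picard_limit t \<kappa>))) (at t within {0..S})"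
    by (intro has_vector_derivative_add has_vector_derivative_const
        integral_has_vector_derivative[OF continuous_on_slice[OF continuous_on_linear_rhs[OF continuous_on_picard_limit]] t])
  then show ?thesis
    by (intro has_vector_derivative_transform[OF t picard_limit_integral_equation]) simp_all
qed

end
end

text \<open>Existence for all parameters at once, because the angles below have to depend continuously on \<open>\<kappa>\<close>.\<close>

lemma reg_system_exists:
  fixes \<sigma> :: "real \<Rightarrow> real"
  assumes \<sigma>: "continuous_on {0..S} \<sigma>" and S: "S \<ge> 0"
  shows "\<exists>u w. (\<forall>\<kappa>. reg_system S \<sigma> \<kappa> (\<lambda>t. u t \<kappa>) (\<lambda>t. w t \<kappa>) \<and> u 0 \<kappa> = u0 \<and> w 0 \<kappa> = w0)
    \<and> continuous_on ({0..S} \<times> UNIV) (\<lambda>(t, \<kappa>). u t \<kappa>) \<and> continuous_on ({0..S} \<times> UNIV) (\<lambda>(t, \<kappa>). w t \<kappa>)"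
proof -
  define g where "g = (\<lambda>t \<kappa>. of_real (\<kappa> + (\<sigma> t)\<^sup>2) :: complex)"
  define \<alpha> where "\<alpha> = (\<lambda>t \<kappa>. \<i> * (1 + g t \<kappa>) / 2)"
  define \<beta> where "\<beta> = (\<lambda>t \<kappa>. of_real (\<sigma> t) + \<i> * (1 - g t \<kappa>) / 2)"
  define Z where "Z = picard_limit \<alpha> \<beta> (Complex w0 u0)"
  have \<sigma>': "continuous_on ({0..S} \<times> UNIV) (\<lambda>x :: real \<times> real. \<sigma> (fst x))"
    by (rule continuous_on_compose2[OF \<sigma>]) (auto intro!: continuous_intros)
  have \<alpha>: "continuous_on ({0..S} \<times> UNIV) (\<lambda>(t, \<kappa>). \<alpha> t \<kappa>)"
    and \<beta>: "continuous_on ({0..S} \<times> UNIV) (\<lambda>(t, \<kappa>). \<beta> t \<kappa>)"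
    unfolding \<alpha>_def \<beta>_def g_def split_def by (intro continuous_intros \<sigma>'; simp)+
  have Zc: "continuous_on ({0..S} \<times> UNIV) (\<lambda>(t, \<kappa>). Z t \<kappa>)"
    unfolding Z_def by (rule continuous_on_picard_limit[OF \<alpha> \<beta>])
  have Z0: "Z 0 \<kappa> = Complex w0 u0" for \<kappa>
    unfolding Z_def using picard_limit_integral_equation[OF \<alpha> \<beta>, of 0] S by simp
  have rhs: "\<alpha> t \<kappa> * z + \<beta> t \<kappa> * cnj z = Complex (\<sigma> t * Re z - (\<kappa> + (\<sigma> t)\<^sup>2) * Im z) (Re z - \<sigma> t * Im z)" for t \<kappa> z
    by (simp add: complex_eq_iff \<alpha>_def \<beta>_def g_def algebra_simps add_divide_distrib diff_divide_distrib)
  have dZ: "((\<lambda>t. Z t \<kappa>) has_vector_derivative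
      Complex (\<sigma> t * Re (Z t \<kappa>) - (\<kappa> + (\<sigma> t)\<^sup>2) * Im (Z t \<kappa>)) (Re (Z t \<kappa>) - \<sigma> t * Im (Z t \<kappa>))) (at t within {0..S})"
    if "t \<in> {0..S}" for t \<kappa>
    using picard_limit_derivative[OF \<alpha> \<beta> that, of "Complex w0 u0" \<kappa>] unfolding rhs Z_def .
  show ?thesis
  proof (rule exI[of _ "\<lambda>t \<kappa>. Im (Z t \<kappa>)"], rule exI[of _ "\<lambda>t \<kappa>. Re (Z t \<kappa>)"], intro conjI allI)
    show "reg_system S \<sigma> \<kappa> (\<lambda>t. Im (Z t \<kappa>)) (\<lambda>t. Re (Z t \<kappa>))" for \<kappa>
      unfolding reg_system_def has_real_derivative_iff_has_vector_derivative
      using dZ[of _ \<kappa>] bounded_linear.has_vector_derivative[OF bounded_linear_Im]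
        bounded_linear.has_vector_derivative[OF bounded_linear_Re] by fastforce
    show "continuous_on ({0..S} \<times> UNIV) (\<lambda>(t, \<kappa>). Im (Z t \<kappa>))" "continuous_on ({0..S} \<times> UNIV) (\<lambda>(t, \<kappa>). Re (Z t \<kappa>))"
      using Zc unfolding split_def by (auto intro: continuous_on_Im continuous_on_Re)
  qed (simp_all add: Z0)
qed

section \<open>Eigenvalues in terms of the regularised system\<close>

text \<open>The choice of \<open>m\<close> as the mean of \<open>q\<close> makes \<open>\<sigma>\<close> vanish at both end points, where therefore \<open>w\<close> agrees with \<open>u'\<close>.\<close>

lemma eigenvalue_iff_reg_system:
  fixes q :: "real \<Rightarrow> real"
  assumes S: "S > 0" and q: "q absolutely_integrable_on {0..S}" and m: "integral {0..S} q = m * S"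
    and \<sigma>: "\<sigma> = (\<lambda>t. integral {0..t} q - m * t)"
  shows "l \<in> eigenvalues B S q \<longleftrightarrow>
    (\<exists>u w. reg_system S \<sigma> (l + m) u w \<and> (u 0 \<noteq> 0 \<or> w 0 \<noteq> 0) \<and> B (u 0) (w 0) (u S) (w S))"
proof -
  have ends: "\<sigma> 0 = 0" "\<sigma> S = 0" using m by (auto simp: \<sigma>)
  have mem: "0 \<in> {0..S}" using S by auto
  have \<sigma>c: "continuous_on {0..S} \<sigma>" by (rule primitive_props(1)[OF q \<sigma>])
  show ?thesis
  proof
    assume "l \<in> eigenvalues B S q"
    then obtain u v t where uv: "is_solution S q l u v" "t \<in> {0..S}" "u t \<noteq> 0" "B (u 0) (v 0) (u S) (v S)"
      by (auto simp: eigenvalues_def)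
    define w where "w = (\<lambda>t. v t + \<sigma> t * u t)"
    have sys: "reg_system S \<sigma> (l + m) u w"
      using is_solution_iff_reg_system[OF q \<sigma>, of w v u l] uv(1) by (simp add: w_def)
    have "u 0 \<noteq> 0 \<or> w 0 \<noteq> 0"
    proof (rule ccontr)
      assume "\<not> ?thesis"
      then have z: "u 0 = 0" "w 0 = 0" by auto
      obtain c c' s s' where c: "reg_system S \<sigma> (l + m) c c'" "c 0 = 1" "c' 0 = 0"
        and s: "reg_system S \<sigma> (l + m) s s'" "s 0 = 0" "s' 0 = 1"
        using reg_system_exists[OF \<sigma>c less_imp_le[OF S], of 1 0] reg_system_exists[OF \<sigma>c less_imp_le[OF S], of 0 1] by blast
      show False
        using reg_system_decompose(1)[OF c s sys uv(2)] z uv(3) by simp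
    qed
    then show "\<exists>u w. reg_system S \<sigma> (l + m) u w \<and> (u 0 \<noteq> 0 \<or> w 0 \<noteq> 0) \<and> B (u 0) (w 0) (u S) (w S)"
      using sys uv(4) ends by (intro exI[of _ u] exI[of _ w]) (auto simp: w_def)
  next
    assume "\<exists>u w. reg_system S \<sigma> (l + m) u w \<and> (u 0 \<noteq> 0 \<or> w 0 \<noteq> 0) \<and> B (u 0) (w 0) (u S) (w S)"
    then obtain u w where uw: "reg_system S \<sigma> (l + m) u w" "u 0 \<noteq> 0 \<or> w 0 \<noteq> 0" "B (u 0) (w 0) (u S) (w S)" by blast
    define v where "v = (\<lambda>t. w t - \<sigma> t * u t)"
    have "is_solution S q l u v"
      using is_solution_iff_reg_system[OF q \<sigma>, of w v u l] uw(1) by (simp add: v_def)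
    moreover have "\<exists>t\<in>{0..S}. u t \<noteq> 0"
      using reg_system_trivial[OF uw(1) S] uw(2) mem by blast
    moreover have "B (u 0) (v 0) (u S) (v S)" using uw(3) ends by (simp add: v_def)
    ultimately show "l \<in> eigenvalues B S q" unfolding eigenvalues_def by blast
  qed
qed

section \<open>The angle of a solution at the right end point\<close>

lemma continuous_stays_below:
  fixes f :: "real \<Rightarrow> real"
  assumes "continuous_on {a..b} f" "a \<le> b" "f a < c" "\<And>t. t \<in> {a..b} \<Longrightarrow> f t \<noteq> c"
  shows "f b < c"
proof (rule ccontr)
  assume "\<not> f b < c"
  then obtain t where "a \<le> t" "t \<le> b" "f t = c"
    using IVT'[of f a c b] assms(1-3) by auto
  then show False using assms(4)[of t] by auto
qed

lemma continuous_stays_above: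
  fixes f :: "real \<Rightarrow> real"
  assumes "continuous_on {a..b} f" "a \<le> b" "f a > c" "\<And>t. t \<in> {a..b} \<Longrightarrow> f t \<noteq> c"
  shows "f b > c"
proof -
  have "continuous_on {a..b} (\<lambda>t. - f t)" by (intro continuous_intros assms)
  then show ?thesis
    using continuous_stays_below[of a b "\<lambda>t. - f t" "- c"] assms by auto
qed

text \<open>Integrating the angular velocity gives a polar angle which is visibly continuous in all parameters, so that no lifting of curves is needed. In the frame rotating with this angle, both components \<open>X\<close>, \<open>Y\<close> of the curve satisfy \<open>f' = \<eta> f\<close>; the factor \<open>exp (- H)\<close> turns them into constants.\<close>

lemma polar_angle_integral:
  fixes x y :: "real \<Rightarrow> real"
  assumes x: "\<And>t. t \<in> {0..S} \<Longrightarrow> (x has_real_derivative x' t) (at t within {0..S})"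
    and y: "\<And>t. t \<in> {0..S} \<Longrightarrow> (y has_real_derivative y' t) (at t within {0..S})"
    and cont: "continuous_on {0..S} x'" "continuous_on {0..S} y'"
    and nz: "\<And>t. t \<in> {0..S} \<Longrightarrow> (x t)\<^sup>2 + (y t)\<^sup>2 > 0"
    and init: "R > 0" "x 0 = R * cos \<psi>" "y 0 = R * sin \<psi>"
    and \<theta>: "\<theta> = (\<lambda>t. \<psi> + integral {0..t} (\<lambda>s. (y' s * x s - y s * x' s) / ((x s)\<^sup>2 + (y s)\<^sup>2)))"
    and t: "t \<in> {0..S}"
  obtains \<rho> where "\<rho> > 0" "x t = \<rho> * cos (\<theta> t)" "y t = \<rho> * sin (\<theta> t)"
proof -
  define N where "N = (\<lambda>s. (x s)\<^sup>2 + (y s)\<^sup>2)"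
  define \<omega> where "\<omega> = (\<lambda>s. (y' s * x s - y s * x' s) / N s)"
  define \<eta> where "\<eta> = (\<lambda>s. (x s * x' s + y s * y' s) / N s)"
  have xc: "continuous_on {0..S} x" using x by (rule DERIV_continuous_on)
  have yc: "continuous_on {0..S} y" using y by (rule DERIV_continuous_on)
  have N0: "N s > 0" if "s \<in> {0..S}" for s using nz[OF that] by (simp add: N_def)
  have Nc: "continuous_on {0..S} N" unfolding N_def by (intro continuous_intros xc yc)
  have \<omega>c: "continuous_on {0..S} \<omega>" unfolding \<omega>_def
    by (intro continuous_intros xc yc cont Nc) (use N0 in force)
  have \<eta>c: "continuous_on {0..S} \<eta>" unfolding \<eta>_def
    by (intro continuous_intros xc yc cont Nc) (use N0 in force)
  define H where "H = (\<lambda>t. integral {0..t} \<eta>)"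
  have d\<theta>: "(\<theta> has_real_derivative \<omega> s) (at s within {0..S})" if "s \<in> {0..S}" for s
    unfolding \<theta> N_def[symmetric] using integral_has_real_derivative[OF \<omega>c that]
    by (auto intro!: derivative_eq_intros simp: \<omega>_def N_def)
  have dH: "(H has_real_derivative \<eta> s) (at s within {0..S})" if "s \<in> {0..S}" for s
    unfolding H_def using integral_has_real_derivative[OF \<eta>c that] .
  define X where "X = (\<lambda>s. (y s * cos (\<theta> s) - x s * sin (\<theta> s)) * exp (- H s))"
  define Y where "Y = (\<lambda>s. (x s * cos (\<theta> s) + y s * sin (\<theta> s)) * exp (- H s))"
  have alg: "(y' s * cos v - x' s * sin v) - \<omega> s * (x s * cos v + y s * sin v) = \<eta> s * (y s * cos v - x s * sin v)"
    "(x' s * cos v + y' s * sin v) + \<omega> s * (y s * cos v - x s * sin v) = \<eta> s * (x s * cos v + y s * sin v)"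
    if s: "s \<in> {0..S}" for s v
  proof -
    have N: "N s \<noteq> 0" "N s = (x s)\<^sup>2 + (y s)\<^sup>2" using N0[OF s] by (auto simp: N_def)
    have \<omega>N: "\<omega> s * N s = y' s * x s - y s * x' s" and \<eta>N: "\<eta> s * N s = x s * x' s + y s * y' s"
      using N(1) by (simp_all add: \<omega>_def \<eta>_def)
    have "N s * ((y' s * cos v - x' s * sin v) - \<omega> s * (x s * cos v + y s * sin v) - \<eta> s * (y s * cos v - x s * sin v)) = 0"
      using \<omega>N \<eta>N N(2) by algebra
    then show "(y' s * cos v - x' s * sin v) - \<omega> s * (x s * cos v + y s * sin v) = \<eta> s * (y s * cos v - x s * sin v)"
      using N(1) by simp
    have "N s * ((x' s * cos v + y' s * sin v) + \<omega> s * (y s * cos v - x s * sin v) - \<eta> s * (x s * cos v + y s * sin v)) = 0"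
      using \<omega>N \<eta>N N(2) by algebra
    then show "(x' s * cos v + y' s * sin v) + \<omega> s * (y s * cos v - x s * sin v) = \<eta> s * (x s * cos v + y s * sin v)"
      using N(1) by simp
  qed
  have dX: "(X has_real_derivative 0) (at s within {0..S})" if s: "s \<in> {0..S}" for s
  proof -
    have "(X has_real_derivative (((y' s * cos (\<theta> s) - x' s * sin (\<theta> s)) - \<omega> s * (x s * cos (\<theta> s) + y s * sin (\<theta> s)))
        - \<eta> s * (y s * cos (\<theta> s) - x s * sin (\<theta> s))) * exp (- H s)) (at s within {0..S})"
      unfolding X_def by (rule derivative_eq_intros x[OF s] y[OF s] d\<theta>[OF s] dH[OF s] refl)+ (simp add: algebra_simps)
    then show ?thesis unfolding alg[OF s] by simp
  qed
  have dY: "(Y has_real_derivative 0) (at s within {0..S})" if s: "s \<in> {0..S}" for s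
  proof -
    have "(Y has_real_derivative (((x' s * cos (\<theta> s) + y' s * sin (\<theta> s)) + \<omega> s * (y s * cos (\<theta> s) - x s * sin (\<theta> s)))
        - \<eta> s * (x s * cos (\<theta> s) + y s * sin (\<theta> s))) * exp (- H s)) (at s within {0..S})"
      unfolding Y_def by (rule derivative_eq_intros x[OF s] y[OF s] d\<theta>[OF s] dH[OF s] refl)+ (simp add: algebra_simps)
    then show ?thesis unfolding alg[OF s] by simp
  qed
  have S0: "0 \<in> {0..S}" using t by auto
  have \<theta>_0: "\<theta> 0 = \<psi>" and H0: "H 0 = 0" unfolding \<theta> H_def by auto
  have "X t = X 0" using has_field_derivative_zero_constant[of "{0..S}" X] dX t S0 by auto
  also have "X 0 = 0" unfolding X_def \<theta>_0 H0 init(2,3) by simp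
  finally have Xt: "y t * cos (\<theta> t) - x t * sin (\<theta> t) = 0" by (simp add: X_def)
  have "Y t = Y 0" using has_field_derivative_zero_constant[of "{0..S}" Y] dY t S0 by auto
  also have "Y 0 = R * cos \<psi> * cos \<psi> + R * sin \<psi> * sin \<psi>" unfolding Y_def \<theta>_0 H0 init(2,3) by simp
  also have "\<dots> = R" using sin_cos_squared_add[of \<psi>] by algebra
  finally have "Y t > 0" using init(1) by simp
  then have "x t * cos (\<theta> t) + y t * sin (\<theta> t) > 0" by (simp add: Y_def zero_less_mult_iff)
  moreover have "x t = (x t * cos (\<theta> t) + y t * sin (\<theta> t)) * cos (\<theta> t)"
    using Xt sin_cos_squared_add[of "\<theta> t"] by algebra
  moreover have "y t = (x t * cos (\<theta> t) + y t * sin (\<theta> t)) * sin (\<theta> t)"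
    using Xt sin_cos_squared_add[of "\<theta> t"] by algebra
  ultimately show ?thesis using that by blast
qed

text \<open>A point where the maximum over \<open>[x, y]\<close> is attained has larger values to its right unless it is \<open>y\<close>.\<close>

lemma strict_mono_if_locally_increasing:
  fixes f :: "real \<Rightarrow> real"
  assumes cont: "continuous_on UNIV f"
    and loc: "\<And>x. \<exists>d>0. \<forall>y. \<bar>y - x\<bar> < d \<longrightarrow> (x < y \<longrightarrow> f x < f y) \<and> (y < x \<longrightarrow> f y < f x)"
  shows "strict_mono f"
proof (rule strict_monoI)
  fix x y :: real assume xy: "x < y"
  have "continuous_on {x..y} f" using cont continuous_on_subset by blast
  then obtain p where p: "p \<in> {x..y}" "\<And>q. q \<in> {x..y} \<Longrightarrow> f q \<le> f p"
    using continuous_attains_sup[of "{x..y}" f] xy by auto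
  have max_is_y: "m = y" if m: "m \<in> {x..y}" "\<And>q. q \<in> {x..y} \<Longrightarrow> f q \<le> f m" for m
  proof (rule ccontr)
    assume "m \<noteq> y"
    then have "m < y" using m by auto
    obtain d where d: "d > 0" "\<forall>q. \<bar>q - m\<bar> < d \<longrightarrow> m < q \<longrightarrow> f m < f q" using loc[of m] by blast
    define q where "q = min y (m + d / 2)"
    have "m < q" "\<bar>q - m\<bar> < d" "q \<in> {x..y}" using d \<open>m < y\<close> m(1) by (auto simp: q_def min_def)
    then show False using d(2) m(2)[of q] by (meson leD)
  qed
  have "p = y" using max_is_y p by blast
  then have "f x \<le> f y" using p xy by auto
  moreover have "f x \<noteq> f y"
    using max_is_y[of x] p \<open>p = y\<close> xy by auto
  ultimately show "f x < f y" by simp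
qed

text \<open>The point where the \<open>k\<close>-th level is attained exists by the intermediate value theorem and depends monotonically on \<open>k\<close>.\<close>

lemma enumerate_levels:
  fixes \<theta> :: "real \<Rightarrow> real" and p :: "nat \<Rightarrow> real"
  assumes cont: "continuous_on UNIV \<theta>" and mono: "strict_mono \<theta>" and p: "strict_mono p"
    and low: "\<theta> x0 < p 0" and unbounded: "\<And>B. \<exists>x. \<theta> x > B"
  obtains f where "strict_mono f" "\<And>k. \<theta> (f k) = p k" "range f = {x. \<exists>k. \<theta> x = p k}"
proof -
  have "\<exists>x. \<theta> x = p k" for k
  proof -
    obtain x1 where x1: "\<theta> x1 > p k" using unbounded by blast
    have "\<theta> x0 < p k" using low strict_mono_less_eq[OF p, of 0 k] by simp
    then have "x0 \<le> x1" using x1 strict_mono_less[OF mono, of x0 x1] by simp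
    then show ?thesis
      using IVT'[of \<theta> x0 "p k" x1] x1 \<open>\<theta> x0 < p k\<close> continuous_on_subset[OF cont] by fastforce
  qed
  then obtain f where f: "\<And>k. \<theta> (f k) = p k" by metis
  have "strict_mono f"
    by (rule strict_monoI) (metis f p strict_mono_less mono)
  moreover have "range f = {x. \<exists>k. \<theta> x = p k}"
    using f strict_mono_eq[OF mono] by (auto simp: image_iff) metis
  ultimately show ?thesis using that f by blast
qed

lemma cos_zero_pos:
  assumes "x > 0" shows "cos x = 0 \<longleftrightarrow> (\<exists>k::nat. x = pi / 2 + real k * pi)"
proof
  assume "cos x = 0"
  then obtain n :: int where n: "x = of_int n * pi + pi / 2" using cos_zero_iff_int2 by blast
  have "n \<ge> 0"
  proof (rule ccontr)
    assume "\<not> n \<ge> 0"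
    then have "real_of_int n * pi \<le> - 1 * pi" by (intro mult_right_mono) auto
    then show False using n assms pi_gt_zero by linarith
  qed
  then show "\<exists>k::nat. x = pi / 2 + real k * pi" using n by (intro exI[of _ "nat n"]) auto
next
  assume "\<exists>k::nat. x = pi / 2 + real k * pi"
  then show "cos x = 0" by (auto simp: cos_add)
qed

lemma sin_zero_pos:
  assumes "x > 0" shows "sin x = 0 \<longleftrightarrow> (\<exists>k::nat. x = real (Suc k) * pi)"
proof
  assume "sin x = 0"
  then obtain n :: int where n: "x = of_int n * pi" using sin_zero_iff_int2 by blast
  have "n \<ge> 1"
  proof (rule ccontr)
    assume "\<not> n \<ge> 1"
    then have "real_of_int n * pi \<le> 0" by (intro mult_nonpos_nonneg) auto
    then show False using n assms by linarith
  qed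
  then show "\<exists>k::nat. x = real (Suc k) * pi" using n by (intro exI[of _ "nat (n - 1)"]) auto
next
  assume "\<exists>k::nat. x = real (Suc k) * pi"
  then show "sin x = 0" by (metis sin_npi)
qed

text \<open>The plane curve \<open>(w, u)\<close> with parameter \<open>\<kappa>\<close>. The two possible initial angles are those of the solutions \<open>s\<close> (angle \<open>0\<close>) and \<open>c\<close> (angle \<open>\<pi>/2\<close>).\<close>

locale pruefer =
  fixes T \<theta>0 :: real and \<sigma> :: "real \<Rightarrow> real" and u w :: "real \<Rightarrow> real \<Rightarrow> real"
  assumes T: "T > 0" and \<sigma>: "continuous_on {0..T} \<sigma>"
    and sys: "\<And>\<kappa>. reg_system T \<sigma> \<kappa> (\<lambda>t. u t \<kappa>) (\<lambda>t. w t \<kappa>)"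
    and u_cont: "continuous_on ({0..T} \<times> UNIV) (\<lambda>(t, \<kappa>). u t \<kappa>)"
    and w_cont: "continuous_on ({0..T} \<times> UNIV) (\<lambda>(t, \<kappa>). w t \<kappa>)"
    and \<theta>0: "\<theta>0 = 0 \<or> \<theta>0 = pi / 2"
    and init: "\<And>\<kappa>. u 0 \<kappa> = sin \<theta>0" "\<And>\<kappa>. w 0 \<kappa> = cos \<theta>0"
    and nonzero: "\<And>t \<kappa>. t \<in> {0..T} \<Longrightarrow> (w t \<kappa>)\<^sup>2 + (u t \<kappa>)\<^sup>2 > 0"
begin

definition rate :: "real \<Rightarrow> real \<Rightarrow> real" where
  "rate t \<kappa> = ((w t \<kappa> - \<sigma> t * u t \<kappa>) * w t \<kappa> - u t \<kappa> * (\<sigma> t * w t \<kappa> - (\<kappa> + (\<sigma> t)\<^sup>2) * u t \<kappa>))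
     / ((w t \<kappa>)\<^sup>2 + (u t \<kappa>)\<^sup>2)"

definition angle :: "real \<Rightarrow> real \<Rightarrow> real" where
  "angle t \<kappa> = \<theta>0 + integral {0..t} (\<lambda>s. rate s \<kappa>)"

lemma slice_cont: "continuous_on {0..T} (\<lambda>t. u t \<kappa>)" "continuous_on {0..T} (\<lambda>t. w t \<kappa>)"
  using reg_system_continuous[OF sys] .

lemma rate_cont: "continuous_on ({0..T} \<times> UNIV) (\<lambda>(t, \<kappa>). rate t \<kappa>)"
proof -
  have "continuous_on ({0..T} \<times> UNIV) (\<lambda>x :: real \<times> real. \<sigma> (fst x))"
    by (rule continuous_on_compose2[OF \<sigma>]) (auto intro!: continuous_intros)
  then show ?thesis
    using u_cont w_cont unfolding rate_def split_def
  proof (intro continuous_intros ballI)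
    fix p :: "real \<times> real" assume "p \<in> {0..T} \<times> UNIV"
    then have "fst p \<in> {0..T}" by auto
    from nonzero[OF this, of "snd p"] show "(w (fst p) (snd p))\<^sup>2 + (u (fst p) (snd p))\<^sup>2 \<noteq> 0" by linarith
  qed
qed

lemma angle_cont_t: "continuous_on {0..T} (\<lambda>t. angle t \<kappa>)"
  unfolding angle_def
  by (intro continuous_intros indefinite_integral_continuous_1 integrable_continuous_real continuous_on_slice[OF rate_cont])

lemma angle_cont: "continuous_on UNIV (angle T)"
proof -
  have "continuous_on (UNIV \<times> cbox 0 T) (\<lambda>p. case (snd p, fst p) of (t, \<kappa>) \<Rightarrow> rate t \<kappa>)"
    by (rule continuous_on_compose2[OF rate_cont]) (auto intro!: continuous_intros)
  then have "continuous_on (UNIV \<times> cbox 0 T) (\<lambda>(\<kappa>, t). rate t \<kappa>)" by (simp add: split_def)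
  then have "continuous_on UNIV (\<lambda>\<kappa>. integral (cbox 0 T) (\<lambda>t. rate t \<kappa>))"
    by (rule integral_continuous_on_param)
  then show ?thesis unfolding angle_def [abs_def] by (intro continuous_intros) simp
qed

lemma angle_0: "angle 0 \<kappa> = \<theta>0" by (simp add: angle_def)

lemma polar:
  assumes "t \<in> {0..T}"
  obtains \<rho> where "\<rho> > 0" "w t \<kappa> = \<rho> * cos (angle t \<kappa>)" "u t \<kappa> = \<rho> * sin (angle t \<kappa>)"
proof (rule polar_angle_integral[where \<theta> = "\<lambda>t. angle t \<kappa>" and S = T and t = t and R = 1 and \<psi> = \<theta>0,
      OF reg_systemD(2)[OF sys[of \<kappa>]] reg_systemD(1)[OF sys[of \<kappa>]]])
  show "continuous_on {0..T} (\<lambda>t. \<sigma> t * w t \<kappa> - (\<kappa> + (\<sigma> t)\<^sup>2) * u t \<kappa>)"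
    "continuous_on {0..T} (\<lambda>t. w t \<kappa> - \<sigma> t * u t \<kappa>)"
    by (intro continuous_intros \<sigma> slice_cont)+
qed (use nonzero init assms that in \<open>auto simp: angle_def rate_def\<close>)

lemma integral_square_pos: "integral {0..T} (\<lambda>t. u t \<kappa> * u t \<kappa>) > 0"
proof -
  have c: "continuous_on {0..T} (\<lambda>t. u t \<kappa> * u t \<kappa>)" by (intro continuous_intros slice_cont)
  have "integral {0..T} (\<lambda>t. u t \<kappa> * u t \<kappa>) \<noteq> 0"
  proof
    assume "integral {0..T} (\<lambda>t. u t \<kappa> * u t \<kappa>) = 0"
    then have u0: "u t \<kappa> = 0" if "t \<in> {0..T}" for t
      using integral_eq_0_iff[OF c T] that by auto
    have mem: "0 \<in> {0..T}" using T by auto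
    show False using reg_system_trivial[OF sys T u0] nonzero[OF mem, of \<kappa>] u0[OF mem] by simp
  qed
  moreover have "integral {0..T} (\<lambda>t. u t \<kappa> * u t \<kappa>) \<ge> 0"
    by (intro Henstock_Kurzweil_Integration.integral_nonneg integrable_continuous_real c) auto
  ultimately show ?thesis by simp
qed

text \<open>The Wronskian at \<open>T\<close> of the solutions for \<open>\<kappa>\<close> and \<open>\<mu>\<close> is \<open>\<kappa> - \<mu>\<close> times the integral of their product, and up to a positive factor it is the sine of the difference of the angles. If \<open>\<mu>\<close> is close to \<open>\<kappa>\<close>, the integral is positive, as it is for \<open>\<mu> = \<kappa>\<close>.\<close>

lemma angle_strict_mono: "strict_mono (angle T)"
proof (rule strict_mono_if_locally_increasing[OF angle_cont])
  fix \<kappa>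
  define I where "I = (\<lambda>\<mu>. integral {0..T} (\<lambda>t. u t \<kappa> * u t \<mu>))"
  have "continuous_on UNIV I"
  proof -
    have "continuous_on (UNIV \<times> cbox 0 T) (\<lambda>p. case (snd p, fst p) of (t, \<kappa>) \<Rightarrow> u t \<kappa>)"
      by (rule continuous_on_compose2[OF u_cont]) (auto intro!: continuous_intros)
    moreover have "continuous_on (UNIV \<times> cbox 0 T) (\<lambda>p :: real \<times> real. u (snd p) \<kappa>)"
      by (rule continuous_on_compose2[OF slice_cont(1)]) (auto intro!: continuous_intros)
    ultimately have "continuous_on (UNIV \<times> cbox 0 T) (\<lambda>(\<mu>, t). u t \<kappa> * u t \<mu>)"
      unfolding split_def by (intro continuous_intros) auto
    then have "continuous_on UNIV (\<lambda>\<mu>. integral (cbox 0 T) (\<lambda>t. u t \<kappa> * u t \<mu>))"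
      by (rule integral_continuous_on_param)
    then show ?thesis by (simp add: I_def)
  qed
  then have "(I \<longlongrightarrow> I \<kappa>) (at \<kappa>)"
    by (simp add: continuous_on_eq_continuous_at isCont_def)
  moreover have "I \<kappa> > 0" unfolding I_def by (rule integral_square_pos)
  ultimately have ev1: "eventually (\<lambda>\<mu>. I \<mu> > 0) (at \<kappa>)" by (rule order_tendstoD(1))
  have "(angle T \<longlongrightarrow> angle T \<kappa>) (at \<kappa>)"
    using angle_cont by (simp add: continuous_on_eq_continuous_at isCont_def)
  then have ev2: "eventually (\<lambda>\<mu>. dist (angle T \<mu>) (angle T \<kappa>) < pi) (at \<kappa>)"
    using pi_gt_zero by (rule tendstoD)
  obtain d where d: "d > 0" "\<And>\<mu>. \<mu> \<noteq> \<kappa> \<Longrightarrow> \<bar>\<mu> - \<kappa>\<bar> < d \<Longrightarrow> I \<mu> > 0 \<and> \<bar>angle T \<mu> - angle T \<kappa>\<bar> < pi"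
    using eventually_conj[OF ev1 ev2] unfolding eventually_at dist_real_def by auto
  show "\<exists>d>0. \<forall>\<mu>. \<bar>\<mu> - \<kappa>\<bar> < d \<longrightarrow> (\<kappa> < \<mu> \<longrightarrow> angle T \<kappa> < angle T \<mu>) \<and> (\<mu> < \<kappa> \<longrightarrow> angle T \<mu> < angle T \<kappa>)"
  proof (intro exI[of _ d] conjI allI impI d(1))
    fix \<mu>
    assume near: "\<bar>\<mu> - \<kappa>\<bar> < d"
    have TT: "T \<in> {0..T}" using T by auto
    obtain \<rho> where \<rho>: "\<rho> > 0" "w T \<kappa> = \<rho> * cos (angle T \<kappa>)" "u T \<kappa> = \<rho> * sin (angle T \<kappa>)" using polar[OF TT] .
    obtain \<rho>' where \<rho>': "\<rho>' > 0" "w T \<mu> = \<rho>' * cos (angle T \<mu>)" "u T \<mu> = \<rho>' * sin (angle T \<mu>)" using polar[OF TT] .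
    have "\<rho> * \<rho>' * sin (angle T \<mu> - angle T \<kappa>) = (\<mu> - \<kappa>) * I \<mu>"
      using wronskian_integral[OF sys[of \<kappa>] sys[of \<mu>]] T unfolding \<rho> \<rho>' init I_def
      by (simp add: sin_diff algebra_simps)
    moreover have "\<rho> * \<rho>' > 0" using \<rho>(1) \<rho>'(1) by simp
    ultimately have sgn: "sin (angle T \<mu> - angle T \<kappa>) > 0 \<longleftrightarrow> (\<mu> - \<kappa>) * I \<mu> > 0"
      "sin (angle T \<mu> - angle T \<kappa>) < 0 \<longleftrightarrow> (\<mu> - \<kappa>) * I \<mu> < 0"
      by (metis mult_less_cancel_left_pos mult_zero_right)+
    { assume "\<kappa> < \<mu>"
      then have "sin (angle T \<mu> - angle T \<kappa>) > 0" "\<bar>angle T \<mu> - angle T \<kappa>\<bar> < pi" using sgn d(2)[OF _ near] by auto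
      then show "angle T \<kappa> < angle T \<mu>"
        using sin_ge_zero[of "angle T \<kappa> - angle T \<mu>"] sin_minus[of "angle T \<mu> - angle T \<kappa>"] by force }
    { assume "\<mu> < \<kappa>"
      then have "sin (angle T \<mu> - angle T \<kappa>) < 0" "\<bar>angle T \<mu> - angle T \<kappa>\<bar> < pi"
        using sgn d(2)[OF _ near] by (auto simp: mult_neg_pos)
      then show "angle T \<mu> < angle T \<kappa>"
        using sin_ge_zero[of "angle T \<mu> - angle T \<kappa>"] by force }
  qed
qed

text \<open>If \<open>\<kappa> + \<sigma>\<^sup>2 < 0\<close> then \<open>(u w)' = w\<^sup>2 - (\<kappa> + \<sigma>\<^sup>2) u\<^sup>2 > 0\<close>. Since \<open>u w\<close> vanishes at \<open>0\<close>, it is positive afterwards, so the curve cannot reach an axis again.\<close>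

lemma angle_first_quadrant:
  obtains \<Lambda> where "\<And>\<kappa>. \<kappa> \<le> \<Lambda> \<Longrightarrow> 0 < angle T \<kappa> \<and> angle T \<kappa> < pi / 2"
proof -
  obtain M where M: "\<And>t. t \<in> {0..T} \<Longrightarrow> \<bar>\<sigma> t\<bar> \<le> M" using continuous_on_interval_bound[OF \<sigma>] by blast
  have "0 < angle T \<kappa> \<and> angle T \<kappa> < pi / 2" if \<kappa>: "\<kappa> \<le> - (M\<^sup>2) - 1" for \<kappa>
  proof -
    have neg: "\<kappa> + (\<sigma> t)\<^sup>2 < 0" if "t \<in> {0..T}" for t
    proof -
      have "(\<sigma> t)\<^sup>2 \<le> M\<^sup>2" using M[OF that] by (metis abs_ge_zero power2_abs power_mono)
      then show ?thesis using \<kappa> by simp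
    qed
    have d: "((\<lambda>t. u t \<kappa> * w t \<kappa>) has_real_derivative (w t \<kappa>)\<^sup>2 - (\<kappa> + (\<sigma> t)\<^sup>2) * (u t \<kappa>)\<^sup>2) (at t within {0..T})"
      if "t \<in> {0..T}" for t
      by (rule derivative_eq_intros reg_systemD[OF sys that] refl)+ (simp add: algebra_simps power2_eq_square)
    have dpos: "(w t \<kappa>)\<^sup>2 - (\<kappa> + (\<sigma> t)\<^sup>2) * (u t \<kappa>)\<^sup>2 > 0" if "t \<in> {0..T}" for t
    proof (cases "u t \<kappa> = 0")
      case True then show ?thesis using nonzero[OF that, of \<kappa>] by simp
    next
      case False
      then have "(\<kappa> + (\<sigma> t)\<^sup>2) * (u t \<kappa>)\<^sup>2 < 0" using neg[OF that] by (simp add: mult_neg_pos)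
      then show ?thesis using zero_le_power2[of "w t \<kappa>"] by linarith
    qed
    have prod0: "u 0 \<kappa> * w 0 \<kappa> = 0" unfolding init using \<theta>0 by (metis cos_pi_half sin_zero mult_zero_left mult_zero_right)
    have prod: "u t \<kappa> * w t \<kappa> > 0" if t: "t \<in> {0<..T}" for t
    proof -
      have "u 0 \<kappa> * w 0 \<kappa> < u t \<kappa> * w t \<kappa>"
      proof (rule DERIV_pos_imp_increasing_open[of 0 t])
        show "continuous_on {0..t} (\<lambda>t. u t \<kappa> * w t \<kappa>)"
          using t by (intro continuous_intros continuous_on_subset[OF slice_cont(1)] continuous_on_subset[OF slice_cont(2)]) auto
        fix x assume x: "0 < x" "x < t"
        then have xT: "x \<in> {0..T}" and "x \<in> interior {0..T}" using t by auto
        then show "\<exists>y. ((\<lambda>t. u t \<kappa> * w t \<kappa>) has_real_derivative y) (at x) \<and> 0 < y"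
          using d[OF xT] dpos[OF xT] by (metis at_within_interior)
      qed (use t in auto)
      then show ?thesis using prod0 by simp
    qed
    have sc: "sin (angle t \<kappa>) * cos (angle t \<kappa>) > 0" if t: "t \<in> {0<..T}" for t
    proof -
      have "t \<in> {0..T}" using t by auto
      then obtain \<rho> where \<rho>: "\<rho> > 0" "w t \<kappa> = \<rho> * cos (angle t \<kappa>)" "u t \<kappa> = \<rho> * sin (angle t \<kappa>)" using polar by blast
      have "\<rho>\<^sup>2 * (sin (angle t \<kappa>) * cos (angle t \<kappa>)) > 0"
        using prod[OF t] unfolding \<rho>(2,3) by (simp add: power2_eq_square algebra_simps)
      then show ?thesis using \<rho>(1) by (simp add: zero_less_mult_iff)
    qed
    have nopi: "angle t \<kappa> \<noteq> pi" "angle t \<kappa> \<noteq> - (pi / 2)" if t: "t \<in> {0..T}" for t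
    proof -
      have "angle t \<kappa> \<noteq> c" if "c = pi \<or> c = - (pi / 2)" for c
      proof (cases "t = 0")
        case True
        then show ?thesis using \<theta>0 that pi_gt_zero by (auto simp: angle_0)
      next
        case False
        then show ?thesis using sc[of t] t that by auto
      qed
      then show "angle t \<kappa> \<noteq> pi" "angle t \<kappa> \<noteq> - (pi / 2)" by auto
    qed
    have \<theta>0_bounds: "\<theta>0 < pi" "\<theta>0 > - (pi / 2)" using \<theta>0 pi_gt_zero by (elim disjE; linarith)+
    have ub: "angle T \<kappa> < pi"
      by (rule continuous_stays_below[OF angle_cont_t]) (use T \<theta>0_bounds nopi in \<open>auto simp: angle_0\<close>)
    have lb: "angle T \<kappa> > - (pi / 2)"
      by (rule continuous_stays_above[OF angle_cont_t]) (use T \<theta>0_bounds nopi in \<open>auto simp: angle_0\<close>)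
    have scT: "sin (angle T \<kappa>) * cos (angle T \<kappa>) > 0" using sc[of T] T by auto
    have "angle T \<kappa> > 0"
    proof (rule ccontr)
      assume "\<not> angle T \<kappa> > 0"
      then have "sin (angle T \<kappa>) \<le> 0" "cos (angle T \<kappa>) \<ge> 0"
        using lb sin_ge_zero[of "- angle T \<kappa>"] cos_ge_zero[of "angle T \<kappa>"] pi_gt_zero by auto
      then show False using scT mult_nonpos_nonneg by (metis not_less)
    qed
    moreover have "angle T \<kappa> < pi / 2"
    proof (rule ccontr)
      assume "\<not> angle T \<kappa> < pi / 2"
      then have "sin (angle T \<kappa>) \<ge> 0" "cos (angle T \<kappa>) \<le> 0"
        using ub sin_ge_zero[of "angle T \<kappa>"] cos_ge_zero[of "pi - angle T \<kappa>"] pi_gt_zero by auto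
      then show False using scT mult_nonneg_nonpos by (metis not_less)
    qed
    ultimately show ?thesis by simp
  qed
  then show ?thesis using that by blast
qed

text \<open>For \<open>\<kappa> = k\<^sup>2\<close> the rescaled curve \<open>(w, k u)\<close> rotates with angular velocity at least \<open>k - M\<close>, where \<open>M\<close> bounds \<open>\<sigma>\<close>. Both curves have the same initial angle and at all times a positive inner product, so their angles differ by less than \<open>\<pi>/2\<close>.\<close>

lemma angle_unbounded:
  obtains \<kappa> where "angle T \<kappa> > B"
proof -
  obtain M where M: "\<And>t. t \<in> {0..T} \<Longrightarrow> \<bar>\<sigma> t\<bar> \<le> M" using continuous_on_interval_bound[OF \<sigma>] by blast
  \<comment> \<open>This choice makes the total rotation \<open>(k - M) T\<close> exceed \<open>B\<close> by more than \<open>\<pi>\<close>.\<close>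
  define k where "k = M + 1 + (\<bar>B\<bar> + pi) / T"
  have M0: "M \<ge> 0" using M[of 0] T by auto
  have k: "k > 0" using M0 T pi_gt_zero by (simp add: k_def add_pos_nonneg)
  define \<kappa> where "\<kappa> = k\<^sup>2"
  define x y where "x = (\<lambda>t. w t \<kappa>)" and "y = (\<lambda>t. k * u t \<kappa>)"
  define x' y' where "x' = (\<lambda>t. \<sigma> t * w t \<kappa> - (\<kappa> + (\<sigma> t)\<^sup>2) * u t \<kappa>)" and "y' = (\<lambda>t. k * (w t \<kappa> - \<sigma> t * u t \<kappa>))"
  define \<omega> where "\<omega> = (\<lambda>s. (y' s * x s - y s * x' s) / ((x s)\<^sup>2 + (y s)\<^sup>2))"
  define \<phi> where "\<phi> = (\<lambda>t. \<theta>0 + integral {0..t} \<omega>)"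
  have dx: "(x has_real_derivative x' t) (at t within {0..T})" if "t \<in> {0..T}" for t
    unfolding x_def x'_def by (rule reg_systemD(2)[OF sys that])
  have dy: "(y has_real_derivative y' t) (at t within {0..T})" if "t \<in> {0..T}" for t
    unfolding y_def y'_def by (intro DERIV_cmult reg_systemD(1)[OF sys that])
  have xc: "continuous_on {0..T} x'" and yc: "continuous_on {0..T} y'"
    unfolding x'_def y'_def by (intro continuous_intros \<sigma> slice_cont)+
  have nz: "(x t)\<^sup>2 + (y t)\<^sup>2 > 0" if "t \<in> {0..T}" for t
    using nonzero[OF that, of \<kappa>] k unfolding x_def y_def
    by (metis add_nonneg_pos add_pos_nonneg less_irrefl mult_eq_0_iff power2_eq_square zero_le_power2 zero_less_power2 add.right_neutral)
  have \<omega>c: "continuous_on {0..T} \<omega>" unfolding \<omega>_def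
    by (intro continuous_intros xc yc DERIV_continuous_on[OF dx] DERIV_continuous_on[OF dy]) (use nz in force)+
  have \<omega>i: "\<omega> integrable_on {0..T}" using \<omega>c by (rule integrable_continuous_real)
  have \<phi>c: "continuous_on {0..T} \<phi>" unfolding \<phi>_def
    by (intro continuous_intros indefinite_integral_continuous_1 \<omega>i)
  have \<omega>_ge: "k - M \<le> \<omega> t" if t: "t \<in> {0..T}" for t
  proof -
    define p q s where "p = w t \<kappa>" and "q = u t \<kappa>" and "s = \<sigma> t"
    have s: "\<bar>s\<bar> \<le> M" using M[OF t] by (simp add: s_def)
    have num: "y' t * x t - y t * x' t = k * (p\<^sup>2 + (k * q)\<^sup>2) + k * s\<^sup>2 * q\<^sup>2 - s * (2 * p * (k * q))"
      unfolding x_def y_def x'_def y'_def \<kappa>_def p_def q_def s_def by (simp add: algebra_simps power2_eq_square)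
    have "\<bar>2 * p * (k * q)\<bar> \<le> p\<^sup>2 + (k * q)\<^sup>2"
      using zero_le_power2[of "p - k * q"] zero_le_power2[of "p + k * q"] by (simp add: power2_sum power2_diff abs_le_iff)
    then have "\<bar>s * (2 * p * (k * q))\<bar> \<le> M * (p\<^sup>2 + (k * q)\<^sup>2)"
      unfolding abs_mult[of s] using s M0 by (intro mult_mono) auto
    then have "s * (2 * p * (k * q)) \<le> M * (p\<^sup>2 + (k * q)\<^sup>2)" by linarith
    moreover have "k * s\<^sup>2 * q\<^sup>2 \<ge> 0" using k by simp
    ultimately have "(k - M) * (p\<^sup>2 + (k * q)\<^sup>2) \<le> y' t * x t - y t * x' t"
      unfolding num by (simp add: left_diff_distrib)
    then show ?thesis unfolding \<omega>_def using nz[OF t] by (simp add: pos_le_divide_eq x_def y_def p_def q_def)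
  qed
  have "(k - M) * T \<le> integral {0..T} \<omega>"
    using integral_le[of "\<lambda>_. k - M" "{0..T}" \<omega>] integrable_const_ivl[of "k - M" 0 T] \<omega>i \<omega>_ge T by (simp add: mult.commute)
  moreover have "(k - M) * T = T + \<bar>B\<bar> + pi" using T by (simp add: k_def field_simps)
  ultimately have big: "\<phi> T \<ge> \<theta>0 + T + \<bar>B\<bar> + pi" by (simp add: \<phi>_def)
  obtain \<rho>0 where \<rho>0: "\<rho>0 > 0" "x 0 = \<rho>0 * cos \<theta>0" "y 0 = \<rho>0 * sin \<theta>0"
  proof (cases "\<theta>0 = 0")
    case True
    then show ?thesis using that[of 1] init by (simp add: x_def y_def)
  next
    case False
    then have "cos \<theta>0 = 0" using \<theta>0 cos_pi_half by metis
    then show ?thesis using that[of k] init k by (simp add: x_def y_def)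
  qed
  have cos_pos: "cos (\<phi> t - angle t \<kappa>) > 0" if t: "t \<in> {0..T}" for t
  proof -
    obtain \<rho> where \<rho>: "\<rho> > 0" "x t = \<rho> * cos (\<phi> t)" "y t = \<rho> * sin (\<phi> t)"
      using polar_angle_integral[OF dx dy xc yc nz \<rho>0 _ t, of \<phi>] unfolding \<phi>_def \<omega>_def by blast
    obtain \<rho>' where \<rho>': "\<rho>' > 0" "w t \<kappa> = \<rho>' * cos (angle t \<kappa>)" "u t \<kappa> = \<rho>' * sin (angle t \<kappa>)" using polar[OF t] .
    have "\<rho> * \<rho>' * cos (\<phi> t - angle t \<kappa>) = x t * w t \<kappa> + y t * u t \<kappa>"
      unfolding \<rho> \<rho>' by (simp add: cos_diff algebra_simps)
    also have "\<dots> = (w t \<kappa>)\<^sup>2 + k * (u t \<kappa>)\<^sup>2" by (simp add: x_def y_def power2_eq_square)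
    also have "\<dots> > 0" using nonzero[OF t, of \<kappa>] k
      by (cases "u t \<kappa> = 0") (auto intro: add_nonneg_pos)
    finally show ?thesis using \<rho>(1) \<rho>'(1) by (rule zero_less_mult_pos[OF _ mult_pos_pos])
  qed
  have "\<phi> T - angle T \<kappa> < pi / 2"
  proof (rule continuous_stays_below[where a = 0 and f = "\<lambda>t. \<phi> t - angle t \<kappa>"])
    show "continuous_on {0..T} (\<lambda>t. \<phi> t - angle t \<kappa>)" by (intro continuous_intros \<phi>c angle_cont_t)
    show "\<phi> t - angle t \<kappa> \<noteq> pi / 2" if "t \<in> {0..T}" for t using cos_pos[OF that] by force
  qed (use T in \<open>auto simp: \<phi>_def angle_0\<close>)
  moreover have "\<theta>0 \<ge> 0" using \<theta>0 pi_gt_zero by (elim disjE; linarith)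
  ultimately have "angle T \<kappa> > B" using big T pi_gt_zero by linarith
  then show ?thesis by (rule that)
qed

lemma eigenvalue_levels:
  fixes p :: "nat \<Rightarrow> real"
  assumes p: "strict_mono p" "p 0 \<ge> pi / 2"
  obtains f where "strict_mono f" "\<And>k. angle T (f k + m) = p k"
    "range f = {l. \<exists>k. angle T (l + m) = p k}"
proof -
  obtain \<Lambda> where \<Lambda>: "\<And>\<kappa>. \<kappa> \<le> \<Lambda> \<Longrightarrow> 0 < angle T \<kappa> \<and> angle T \<kappa> < pi / 2"
    using angle_first_quadrant by blast
  have "continuous_on UNIV (\<lambda>l. angle T (l + m))"
    by (rule continuous_on_compose2[OF angle_cont]) (auto intro!: continuous_intros)
  moreover have "strict_mono (\<lambda>l. angle T (l + m))"
    by (rule strict_monoI) (use strict_mono_less[OF angle_strict_mono] in simp)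
  moreover have "angle T ((\<Lambda> - m) + m) < p 0" using \<Lambda>[of \<Lambda>] p(2) by simp
  moreover have "\<exists>l. angle T (l + m) > B" for B
  proof -
    obtain \<kappa> where "angle T \<kappa> > B" using angle_unbounded by blast
    then show ?thesis by (intro exI[of _ "\<kappa> - m"]) simp
  qed
  ultimately show ?thesis
    using enumerate_levels[of "\<lambda>l. angle T (l + m)" p "\<Lambda> - m"] p(1) that by blast
qed

lemma angle_pos: "angle T \<kappa> > 0"
proof -
  obtain \<Lambda> where \<Lambda>: "\<And>\<kappa>. \<kappa> \<le> \<Lambda> \<Longrightarrow> 0 < angle T \<kappa> \<and> angle T \<kappa> < pi / 2"
    using angle_first_quadrant by blast
  have "angle T (min \<kappa> \<Lambda>) \<le> angle T \<kappa>" using strict_mono_less_eq[OF angle_strict_mono] by simp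
  then show ?thesis using \<Lambda>[of "min \<kappa> \<Lambda>"] by simp
qed

lemma end_zeros:
  "u T \<kappa> = 0 \<longleftrightarrow> (\<exists>k. angle T \<kappa> = real (Suc k) * pi)"
  "w T \<kappa> = 0 \<longleftrightarrow> (\<exists>k. angle T \<kappa> = pi / 2 + real k * pi)"
proof -
  have "T \<in> {0..T}" using T by simp
  then obtain \<rho> where \<rho>: "\<rho> > 0" "w T \<kappa> = \<rho> * cos (angle T \<kappa>)" "u T \<kappa> = \<rho> * sin (angle T \<kappa>)" using polar by blast
  show "u T \<kappa> = 0 \<longleftrightarrow> (\<exists>k. angle T \<kappa> = real (Suc k) * pi)"
    unfolding \<rho>(3) sin_zero_pos[OF angle_pos, symmetric] using \<rho>(1) by simp
  show "w T \<kappa> = 0 \<longleftrightarrow> (\<exists>k. angle T \<kappa> = pi / 2 + real k * pi)"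
    unfolding \<rho>(2) cos_zero_pos[OF angle_pos, symmetric] using \<rho>(1) by simp
qed

end

section \<open>Interlacing\<close>

lemma strict_mono_same_range:
  fixes f g :: "nat \<Rightarrow> real"
  assumes "strict_mono f" "strict_mono g" "range f = range g"
  shows "f = g"
proof
  fix n
  show "f n = g n"
  proof (induction n rule: less_induct)
    case (less n)
    obtain m where m: "f n = g m" using assms(3) by (metis rangeI imageE)
    obtain k where k: "g n = f k" using assms(3) by (metis rangeI imageE)
    have "n \<le> m" using less[of m] m strict_mono_eq[OF assms(1), of n m] by force
    then have "g n \<le> f n" using m strict_mono_less_eq[OF assms(2)] by simp
    have "n \<le> k" using less[of k] k strict_mono_eq[OF assms(2), of n k] by force
    then have "f n \<le> g n" using k strict_mono_less_eq[OF assms(1)] by simp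
    then show ?case using \<open>g n \<le> f n\<close> by simp
  qed
qed

lemma eigenvalue_eqI:
  assumes "strict_mono f" "range f = eigenvalues B S q"
  shows "eigenvalue B S q = f"
  unfolding eigenvalue_def using assms strict_mono_same_range by (intro the_equality) auto

text \<open>The difference of the angles cannot leave \<open>(0, \<pi>)\<close>, since its sine is positive; for very negative \<open>\<kappa>\<close> it is in this interval.\<close>

lemma angle_gap:
  fixes P Q :: "real \<Rightarrow> real"
  assumes cont: "continuous_on UNIV P" "continuous_on UNIV Q"
    and sin_pos: "\<And>\<kappa>. sin (P \<kappa> - Q \<kappa>) > 0"
    and low: "\<And>\<kappa>. \<kappa> \<le> \<Lambda> \<Longrightarrow> \<bar>P \<kappa> - Q \<kappa>\<bar> < pi"
  shows "Q \<kappa> < P \<kappa>" "P \<kappa> < Q \<kappa> + pi"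
proof -
  define x0 where "x0 = min \<kappa> \<Lambda>"
  have c: "continuous_on {x0..\<kappa>} (\<lambda>x. P x - Q x)"
    using continuous_on_subset[OF cont(1)] continuous_on_subset[OF cont(2)] by (intro continuous_intros) auto
  have start: "P x0 - Q x0 > 0" "P x0 - Q x0 < pi"
    using low[of x0] sin_pos[of x0] sin_ge_zero[of "Q x0 - P x0"] sin_minus[of "P x0 - Q x0"]
    by (auto simp: x0_def) force+
  have "P x - Q x \<noteq> 0" "P x - Q x \<noteq> pi" for x using sin_pos[of x] by (metis less_irrefl sin_zero sin_pi)+
  then have "P \<kappa> - Q \<kappa> > 0" "P \<kappa> - Q \<kappa> < pi"
    using continuous_stays_above[OF c _ start(1)] continuous_stays_below[OF c _ start(2)] by (auto simp: x0_def)
  then show "Q \<kappa> < P \<kappa>" "P \<kappa> < Q \<kappa> + pi" by auto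
qed

text \<open>Each inequality \<open>x < y\<close> follows from \<open>P x < P y\<close> or from \<open>Q x < Q y\<close>. If \<open>x\<close> and \<open>y\<close> are defined by levels of different angles, the gap between \<open>P\<close> and \<open>Q\<close> transfers the level of one of the two points.\<close>

lemma interlacing_of_angles:
  fixes P Q :: "real \<Rightarrow> real" and N D M1 M2 :: "nat \<Rightarrow> real"
  assumes mono: "strict_mono P" "strict_mono Q"
    and gap: "\<And>x. Q x < P x" "\<And>x. P x < Q x + pi"
    and N: "\<And>k. P (N k) = pi / 2 + real k * pi" and M1: "\<And>k. P (M1 k) = real (Suc k) * pi"
    and M2: "\<And>k. Q (M2 k) = pi / 2 + real k * pi" and D: "\<And>k. Q (D k) = real (Suc k) * pi"
  shows "N 0 < min (M1 0) (M2 0)"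
    and "max (M1 k) (M2 k) < min (D k) (N (Suc k))"
    and "max (D k) (N (Suc k)) < min (M1 (Suc k)) (M2 (Suc k))"
proof -
  have P: "P x < P y \<Longrightarrow> x < y" and Q: "Q x < Q y \<Longrightarrow> x < y" for x y
    using strict_mono_less[OF mono(1)] strict_mono_less[OF mono(2)] by auto
  have suc: "real (Suc j) * pi = real j * pi + pi" for j by (simp add: algebra_simps)
  note lev = N M1 M2 D suc
  have "N 0 < M1 0" by (rule P) (use pi_gt_zero in \<open>simp add: lev del: of_nat_Suc\<close>)
  moreover have "N 0 < M2 0" by (rule P) (use gap(1)[of "M2 0"] in \<open>simp add: lev del: of_nat_Suc\<close>)
  ultimately show "N 0 < min (M1 0) (M2 0)" by simp
  have "M1 k < D k" by (rule P) (use gap(1)[of "D k"] in \<open>simp add: lev del: of_nat_Suc\<close>)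
  moreover have "M1 k < N (Suc k)" by (rule P) (use pi_gt_zero in \<open>simp add: lev del: of_nat_Suc\<close>)
  moreover have "M2 k < D k" by (rule Q) (use pi_gt_zero in \<open>simp add: lev del: of_nat_Suc\<close>)
  moreover have "M2 k < N (Suc k)" by (rule Q) (use gap(2)[of "N (Suc k)"] in \<open>simp add: lev del: of_nat_Suc\<close>)
  ultimately show "max (M1 k) (M2 k) < min (D k) (N (Suc k))" by simp
  have "D k < M1 (Suc k)" by (rule Q) (use gap(2)[of "M1 (Suc k)"] in \<open>simp add: lev del: of_nat_Suc\<close>)
  moreover have "D k < M2 (Suc k)" by (rule Q) (use pi_gt_zero in \<open>simp add: lev del: of_nat_Suc\<close>)
  moreover have "N (Suc k) < M1 (Suc k)" by (rule P) (use pi_gt_zero in \<open>simp add: lev del: of_nat_Suc\<close>)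
  moreover have "N (Suc k) < M2 (Suc k)" by (rule P) (use gap(1)[of "M2 (Suc k)"] in \<open>simp add: lev del: of_nat_Suc\<close>)
  ultimately show "max (D k) (N (Suc k)) < min (M1 (Suc k)) (M2 (Suc k))" by simp
qed

section \<open>Reflections and the periodic problem\<close>

lemma reg_system_shift:
  assumes sys: "reg_system S \<tau> \<kappa> U W" and p: "0 \<le> p" "p + T \<le> S"
    and \<sigma>: "\<And>t. t \<in> {0..T} \<Longrightarrow> \<tau> (p + t) = \<sigma> t"
  shows "reg_system T \<sigma> \<kappa> (\<lambda>t. U (p + t)) (\<lambda>t. W (p + t))"
  unfolding reg_system_def
proof (intro ballI conjI)
  fix t assume t: "t \<in> {0..T}"
  have im: "(\<lambda>t. p + t) ` {0..T} \<subseteq> {0..S}" using p by auto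
  have pt: "p + t \<in> {0..S}" using p t by auto
  have d: "((\<lambda>t. p + t) has_real_derivative 1) (at t within {0..T})" by (auto intro!: derivative_eq_intros)
  show "((\<lambda>t. U (p + t)) has_real_derivative W (p + t) - \<sigma> t * U (p + t)) (at t within {0..T})"
    using DERIV_image_chain[OF DERIV_subset[OF reg_systemD(1)[OF sys pt] im] d] \<sigma>[OF t] by (simp add: o_def)
  show "((\<lambda>t. W (p + t)) has_real_derivative \<sigma> t * W (p + t) - (\<kappa> + (\<sigma> t)\<^sup>2) * U (p + t)) (at t within {0..T})"
    using DERIV_image_chain[OF DERIV_subset[OF reg_systemD(2)[OF sys pt] im] d] \<sigma>[OF t] by (simp add: o_def)
qed

text \<open>Reading a solution backwards changes the sign of its derivative and of the primitive of the potential.\<close>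

lemma reg_system_reflect:
  assumes sys: "reg_system S \<tau> \<kappa> U W" and p: "T \<le> p" "p \<le> S"
    and \<sigma>: "\<And>t. t \<in> {0..T} \<Longrightarrow> \<tau> (p - t) = - \<sigma> t"
  shows "reg_system T \<sigma> \<kappa> (\<lambda>t. U (p - t)) (\<lambda>t. - W (p - t))"
  unfolding reg_system_def
proof (intro ballI conjI)
  fix t assume t: "t \<in> {0..T}"
  have im: "(\<lambda>t. p - t) ` {0..T} \<subseteq> {0..S}" using p by auto
  have pt: "p - t \<in> {0..S}" using p t by auto
  have d: "((\<lambda>t. p - t) has_real_derivative - 1) (at t within {0..T})" by (auto intro!: derivative_eq_intros)
  show "((\<lambda>t. U (p - t)) has_real_derivative - W (p - t) - \<sigma> t * U (p - t)) (at t within {0..T})"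
    using DERIV_image_chain[OF DERIV_subset[OF reg_systemD(1)[OF sys pt] im] d] \<sigma>[OF t] by (simp add: o_def)
  have "((\<lambda>t. W (p - t)) has_real_derivative \<sigma> t * W (p - t) + (\<kappa> + (\<sigma> t)\<^sup>2) * U (p - t)) (at t within {0..T})"
    using DERIV_image_chain[OF DERIV_subset[OF reg_systemD(2)[OF sys pt] im] d] \<sigma>[OF t] by (simp add: o_def add.commute)
  from DERIV_minus[OF this]
  show "((\<lambda>t. - W (p - t)) has_real_derivative \<sigma> t * - W (p - t) - (\<kappa> + (\<sigma> t)\<^sup>2) * U (p - t)) (at t within {0..T})"
    by simp
qed

lemma even_ext_has_integral:
  fixes f :: "real \<Rightarrow> real"
  assumes f: "f integrable_on {0..S}" and t: "t \<in> {0..S}"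
  shows "(even_ext S f has_integral 2 * integral {0..S} f - integral {0..t} f) {0..2 * S - t}"
proof -
  have "f integrable_on {t..S}" by (rule integrable_on_subinterval[OF f]) (use t in auto)
  then have "(f has_integral integral {t..S} f) (cbox t S)" by (simp add: integrable_integral)
  from has_integral_affinity[OF this, of "- 1" "2 * S"]
  have "((\<lambda>x. f (2 * S - x)) has_integral integral {t..S} f) ((\<lambda>x. 2 * S - x) ` {t..S})"
    by (simp add: algebra_simps)
  moreover have "(\<lambda>x. 2 * S - x) ` {t..S} = {S..2 * S - t}"
  proof
    show "{S..2 * S - t} \<subseteq> (\<lambda>x. 2 * S - x) ` {t..S}"
    proof
      fix y assume "y \<in> {S..2 * S - t}"
      then show "y \<in> (\<lambda>x. 2 * S - x) ` {t..S}" by (intro image_eqI[of _ _ "2 * S - y"]) auto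
    qed
  qed auto
  ultimately have "((\<lambda>x. f (2 * S - x)) has_integral integral {t..S} f) {S..2 * S - t}" by simp
  then have 2: "(even_ext S f has_integral integral {t..S} f) {S..2 * S - t}"
    by (rule has_integral_eq[rotated]) (auto simp: even_ext_def)
  have 1: "(even_ext S f has_integral integral {0..S} f) {0..S}"
    using integrable_integral[OF f] by (rule has_integral_eq[rotated]) (auto simp: even_ext_def)
  have "integral {0..t} f + integral {t..S} f = integral {0..S} f"
    using t f by (intro Henstock_Kurzweil_Integration.integral_combine) auto
  moreover have "(even_ext S f has_integral integral {0..S} f + integral {t..S} f) {0..2 * S - t}"
    by (rule has_integral_combine[OF _ _ 1 2]) (use t in auto)
  moreover have "2 * integral {0..S} f - integral {0..t} f = integral {0..S} f + integral {t..S} f"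
    using calculation by linarith
  ultimately show ?thesis by metis
qed

lemma even_ext_absolutely_integrable:
  assumes q: "q absolutely_integrable_on {0..S}" and S: "S > 0"
  shows "even_ext S q absolutely_integrable_on {0..2 * S}"
proof -
  have "q integrable_on {0..S}" "(\<lambda>x. norm (q x)) integrable_on {0..S}"
    using q unfolding absolutely_integrable_on_def by auto
  moreover have "(\<lambda>x. norm (even_ext S q x)) = even_ext S (\<lambda>x. norm (q x))"
    by (auto simp: even_ext_def)
  ultimately show ?thesis
    unfolding absolutely_integrable_on_def
    using even_ext_has_integral[of _ S 0] S by (auto intro: has_integral_integrable)
qed

text \<open>About the point \<open>S\<close> the extended potential minus its mean is even, so its primitive, which vanishes there, is odd.\<close>

lemma even_ext_primitive:
  fixes q :: "real \<Rightarrow> real"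
  assumes q: "q absolutely_integrable_on {0..S}" and m: "integral {0..S} q = m * S" and t: "t \<in> {0..S}"
  shows "integral {0..t} (even_ext S q) - m * t = integral {0..t} q - m * t"
    and "integral {0..2 * S - t} (even_ext S q) - m * (2 * S - t) = - (integral {0..t} q - m * t)"
proof -
  have qi: "q integrable_on {0..S}" using q set_lebesgue_integral_eq_integral(1) by blast
  have "integral {0..t} (even_ext S q) = integral {0..t} q"
    by (rule Henstock_Kurzweil_Integration.integral_cong) (use t in \<open>auto simp: even_ext_def\<close>)
  then show "integral {0..t} (even_ext S q) - m * t = integral {0..t} q - m * t" by simp
  show "integral {0..2 * S - t} (even_ext S q) - m * (2 * S - t) = - (integral {0..t} q - m * t)"
    using integral_unique[OF even_ext_has_integral[OF qi t]] m by (simp add: algebra_simps)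
qed

text \<open>Here \<open>(x, y)\<close>, \<open>(X, Y)\<close>, \<open>(x', y')\<close> stand for the values of \<open>(u, u')\<close> at \<open>0\<close>, \<open>2T\<close>, \<open>4T\<close>, and the equations express that the pieces fit at \<open>T\<close> and at \<open>3T\<close>. In the periodic case, sums and differences of the equations give \<open>c (X - x) = s (Y + y) = c' (X + x) = s' (Y - y) = 0\<close>.\<close>

lemma periodic_matching:
  fixes c c' s s' :: real
  assumes W: "c * s' - c' * s = 1"
    and eq1: "c * x + s * y = c * X - s * Y" "c' * x + s' * y = - (c' * X - s' * Y)"
    and eq2: "c * X + s * Y = c * x' - s * y'" "c' * X + s' * Y = - (c' * x' - s' * y')"
  shows "x' = x \<Longrightarrow> y' = y \<Longrightarrow> x \<noteq> 0 \<or> y \<noteq> 0 \<Longrightarrow> c = 0 \<or> s = 0 \<or> c' = 0 \<or> s' = 0"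
    and "c = 0 \<or> c' = 0 \<Longrightarrow> y = 0 \<Longrightarrow> x' = x \<and> y' = y"
    and "s = 0 \<or> s' = 0 \<Longrightarrow> x = 0 \<Longrightarrow> x' = x \<and> y' = y"
proof -
  assume a: "x' = x" "y' = y" "x \<noteq> 0 \<or> y \<noteq> 0"
  have "c * (X - x) = 0" "s * (Y + y) = 0" "c' * (X + x) = 0" "s' * (Y - y) = 0"
    using eq1 eq2 unfolding a by algebra+
  then show "c = 0 \<or> s = 0 \<or> c' = 0 \<or> s' = 0" using a(3) by auto
next
  show "c = 0 \<or> c' = 0 \<Longrightarrow> y = 0 \<Longrightarrow> x' = x \<and> y' = y"
    using W eq1 eq2 by (elim disjE) (simp_all, algebra+)
  show "s = 0 \<or> s' = 0 \<Longrightarrow> x = 0 \<Longrightarrow> x' = x \<and> y' = y"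
    using W eq1 eq2 by (elim disjE) (simp_all, algebra+)
qed


theorem mainTheorem13:
  fixes T :: real and a :: "real \<Rightarrow> real"
  assumes "T > 0"
    and "a absolutely_integrable_on {0..T}"
  shows "eigenvalues bc_periodic (4 * T) (even_ext (2 * T) (even_ext T a)) =
           range (eigenvalue bc_N T a) \<union> range (eigenvalue bc_D T a) \<union>
           range (eigenvalue bc_M1 T a) \<union> range (eigenvalue bc_M2 T a)
       \<and> eigenvalue bc_N T a 0 < min (eigenvalue bc_M1 T a 0) (eigenvalue bc_M2 T a 0)
       \<and> (\<forall>k. max (eigenvalue bc_M1 T a k) (eigenvalue bc_M2 T a k)
                < min (eigenvalue bc_D T a k) (eigenvalue bc_N T a (Suc k))
            \<and> max (eigenvalue bc_D T a k) (eigenvalue bc_N T a (Suc k))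
                < min (eigenvalue bc_M1 T a (Suc k)) (eigenvalue bc_M2 T a (Suc k)))"
proof -
  note T = assms(1) and a = assms(2)
  define m where "m = integral {0..T} a / T"
  define \<sigma> where "\<sigma> = (\<lambda>t. integral {0..t} a - m * t)"
  have m: "integral {0..T} a = m * T" using T by (simp add: m_def)
  have \<sigma>c: "continuous_on {0..T} \<sigma>" by (rule primitive_props(1)[OF a \<sigma>_def])
  have TT: "T \<in> {0..T}" and T0: "0 \<in> {0..T}" using T by auto
  obtain c c' where c: "\<forall>\<kappa>. reg_system T \<sigma> \<kappa> (\<lambda>t. c t \<kappa>) (\<lambda>t. c' t \<kappa>) \<and> c 0 \<kappa> = 1 \<and> c' 0 \<kappa> = 0"
    "continuous_on ({0..T} \<times> UNIV) (\<lambda>(t, \<kappa>). c t \<kappa>)" "continuous_on ({0..T} \<times> UNIV) (\<lambda>(t, \<kappa>). c' t \<kappa>)"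
    using reg_system_exists[OF \<sigma>c less_imp_le[OF T], of 1 0] by blast
  obtain s s' where s: "\<forall>\<kappa>. reg_system T \<sigma> \<kappa> (\<lambda>t. s t \<kappa>) (\<lambda>t. s' t \<kappa>) \<and> s 0 \<kappa> = 0 \<and> s' 0 \<kappa> = 1"
    "continuous_on ({0..T} \<times> UNIV) (\<lambda>(t, \<kappa>). s t \<kappa>)" "continuous_on ({0..T} \<times> UNIV) (\<lambda>(t, \<kappa>). s' t \<kappa>)"
    using reg_system_exists[OF \<sigma>c less_imp_le[OF T], of 0 1] by blast
  have csys: "reg_system T \<sigma> \<kappa> (\<lambda>t. c t \<kappa>) (\<lambda>t. c' t \<kappa>)" "c 0 \<kappa> = 1" "c' 0 \<kappa> = 0" for \<kappa>
    using c(1) by auto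
  have ssys: "reg_system T \<sigma> \<kappa> (\<lambda>t. s t \<kappa>) (\<lambda>t. s' t \<kappa>)" "s 0 \<kappa> = 0" "s' 0 \<kappa> = 1" for \<kappa>
    using s(1) by auto
  have W: "c t \<kappa> * s' t \<kappa> - c' t \<kappa> * s t \<kappa> = 1" if "t \<in> {0..T}" for t \<kappa>
    using wronskian_const[OF csys(1) ssys(1) that, of \<kappa>] csys(2,3) ssys(2,3) by simp
  have c_nz: "(c' t \<kappa>)\<^sup>2 + (c t \<kappa>)\<^sup>2 > 0" if "t \<in> {0..T}" for t \<kappa>
    using W[OF that, of \<kappa>] by (auto simp: sum_power2_gt_zero_iff)
  have s_nz: "(s' t \<kappa>)\<^sup>2 + (s t \<kappa>)\<^sup>2 > 0" if "t \<in> {0..T}" for t \<kappa>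
    using W[OF that, of \<kappa>] by (auto simp: sum_power2_gt_zero_iff)
  interpret C: pruefer T "pi / 2" \<sigma> c c'
    by unfold_locales (use T \<sigma>c c csys c_nz in \<open>auto simp del: sum_power2_gt_zero_iff\<close>)
  interpret S: pruefer T 0 \<sigma> s s'
    by unfold_locales (use T \<sigma>c s ssys s_nz in \<open>auto simp del: sum_power2_gt_zero_iff\<close>)
  define P where "P = (\<lambda>l. C.angle T (l + m))"
  define Q where "Q = (\<lambda>l. S.angle T (l + m))"

  have gap: "S.angle T \<kappa> < C.angle T \<kappa>" "C.angle T \<kappa> < S.angle T \<kappa> + pi" for \<kappa>
  proof -
    obtain L1 where L1: "\<And>\<kappa>. \<kappa> \<le> L1 \<Longrightarrow> 0 < C.angle T \<kappa> \<and> C.angle T \<kappa> < pi / 2"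
      using C.angle_first_quadrant by blast
    obtain L2 where L2: "\<And>\<kappa>. \<kappa> \<le> L2 \<Longrightarrow> 0 < S.angle T \<kappa> \<and> S.angle T \<kappa> < pi / 2"
      using S.angle_first_quadrant by blast
    have sin_pos: "sin (C.angle T \<kappa> - S.angle T \<kappa>) > 0" for \<kappa>
    proof -
      obtain \<rho> where \<rho>: "\<rho> > 0" "c' T \<kappa> = \<rho> * cos (C.angle T \<kappa>)" "c T \<kappa> = \<rho> * sin (C.angle T \<kappa>)" using C.polar[OF TT] .
      obtain \<rho>' where \<rho>': "\<rho>' > 0" "s' T \<kappa> = \<rho>' * cos (S.angle T \<kappa>)" "s T \<kappa> = \<rho>' * sin (S.angle T \<kappa>)" using S.polar[OF TT] .
      have "\<rho> * \<rho>' * sin (C.angle T \<kappa> - S.angle T \<kappa>) = 1"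
        using W[OF TT, of \<kappa>] unfolding \<rho> \<rho>' by (simp add: sin_diff algebra_simps)
      then show ?thesis using zero_less_mult_pos[of "\<rho> * \<rho>'" "sin (C.angle T \<kappa> - S.angle T \<kappa>)"] \<rho>(1) \<rho>'(1) by simp
    qed
    have low: "\<bar>C.angle T \<kappa> - S.angle T \<kappa>\<bar> < pi" if "\<kappa> \<le> min L1 L2" for \<kappa>
      using L1[of \<kappa>] L2[of \<kappa>] that by (simp add: abs_less_iff)
    show "S.angle T \<kappa> < C.angle T \<kappa>" "C.angle T \<kappa> < S.angle T \<kappa> + pi"
      by (rule angle_gap[OF C.angle_cont S.angle_cont sin_pos low]; assumption)+
  qed

  have bvp: "l \<in> eigenvalues B T a \<longleftrightarrow> (\<exists>x y. (x \<noteq> 0 \<or> y \<noteq> 0) \<and>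
     B x y (x * c T (l + m) + y * s T (l + m)) (x * c' T (l + m) + y * s' T (l + m)))" for B l
  proof
    assume "l \<in> eigenvalues B T a"
    then obtain u w where uw: "reg_system T \<sigma> (l + m) u w" "u 0 \<noteq> 0 \<or> w 0 \<noteq> 0" "B (u 0) (w 0) (u T) (w T)"
      using eigenvalue_iff_reg_system[OF T a m \<sigma>_def] by blast
    then show "\<exists>x y. (x \<noteq> 0 \<or> y \<noteq> 0) \<and>
       B x y (x * c T (l + m) + y * s T (l + m)) (x * c' T (l + m) + y * s' T (l + m))"
      using reg_system_decompose[OF csys ssys uw(1) TT] by auto
  next
    assume "\<exists>x y. (x \<noteq> 0 \<or> y \<noteq> 0) \<and>
       B x y (x * c T (l + m) + y * s T (l + m)) (x * c' T (l + m) + y * s' T (l + m))"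
    then obtain x y where xy: "x \<noteq> 0 \<or> y \<noteq> 0"
       "B x y (x * c T (l + m) + y * s T (l + m)) (x * c' T (l + m) + y * s' T (l + m))" by blast
    then show "l \<in> eigenvalues B T a"
      unfolding eigenvalue_iff_reg_system[OF T a m \<sigma>_def]
      using reg_system_comb[OF csys(1) ssys(1), of "l + m" x y] csys(2,3) ssys(2,3)
      by (intro exI conjI) (assumption | simp)+
  qed
  have setN: "eigenvalues bc_N T a = {l. c' T (l + m) = 0}"
    by (auto simp: bvp bc_N_def intro: exI[of _ 1])
  have setM1: "eigenvalues bc_M1 T a = {l. c T (l + m) = 0}"
    by (auto simp: bvp bc_M1_def intro: exI[of _ 1])
  have setM2: "eigenvalues bc_M2 T a = {l. s' T (l + m) = 0}"
    by (auto simp: bvp bc_M2_def intro: exI[of _ 1])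
  have setD: "eigenvalues bc_D T a = {l. s T (l + m) = 0}"
    by (auto simp: bvp bc_D_def intro: exI[of _ 1])

  have p1: "strict_mono (\<lambda>k. pi / 2 + real k * pi)" "strict_mono (\<lambda>k. real (Suc k) * pi)"
    by (auto intro!: strict_monoI simp del: of_nat_Suc)
  obtain fN where fN: "strict_mono fN" "\<And>k. P (fN k) = pi / 2 + real k * pi" "range fN = eigenvalues bc_N T a"
    using C.eigenvalue_levels[OF p1(1), of m] unfolding P_def setN C.end_zeros by auto
  obtain fM1 where fM1: "strict_mono fM1" "\<And>k. P (fM1 k) = real (Suc k) * pi" "range fM1 = eigenvalues bc_M1 T a"
    using C.eigenvalue_levels[OF p1(2), of m] unfolding P_def setM1 C.end_zeros by auto
  obtain fM2 where fM2: "strict_mono fM2" "\<And>k. Q (fM2 k) = pi / 2 + real k * pi" "range fM2 = eigenvalues bc_M2 T a"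
    using S.eigenvalue_levels[OF p1(1), of m] unfolding Q_def setM2 S.end_zeros by auto
  obtain fD where fD: "strict_mono fD" "\<And>k. Q (fD k) = real (Suc k) * pi" "range fD = eigenvalues bc_D T a"
    using S.eigenvalue_levels[OF p1(2), of m] unfolding Q_def setD S.end_zeros by auto
  note ev = eigenvalue_eqI[OF fN(1,3)] eigenvalue_eqI[OF fD(1,3)] eigenvalue_eqI[OF fM1(1,3)] eigenvalue_eqI[OF fM2(1,3)]
  have mono: "strict_mono P" "strict_mono Q"
    unfolding P_def Q_def
    using strict_mono_less[OF C.angle_strict_mono] strict_mono_less[OF S.angle_strict_mono]
    by (auto intro!: strict_monoI)
  have gap': "Q l < P l" "P l < Q l + pi" for l using gap by (auto simp: P_def Q_def)
  note order = interlacing_of_angles[OF mono gap' fN(2) fM1(2) fM2(2) fD(2)]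

  define q where "q = even_ext (2 * T) (even_ext T a)"
  define \<tau> where "\<tau> = (\<lambda>t. integral {0..t} q - m * t)"
  define \<tau>1 where "\<tau>1 = (\<lambda>t. integral {0..t} (even_ext T a) - m * t)"
  have a1: "even_ext T a absolutely_integrable_on {0..2 * T}"
    by (rule even_ext_absolutely_integrable[OF a T])
  have m1: "integral {0..2 * T} (even_ext T a) = m * (2 * T)"
    using even_ext_primitive(2)[OF a m T0] by simp
  have qi: "q absolutely_integrable_on {0..4 * T}"
    using even_ext_absolutely_integrable[OF a1] T by (simp add: q_def)
  have m2: "integral {0..4 * T} q = m * (4 * T)"
    using even_ext_primitive(2)[OF a1 m1, of 0] T by (simp add: q_def)
  have \<tau>1: "\<tau>1 t = \<sigma> t" "\<tau>1 (2 * T - t) = - \<sigma> t" if "t \<in> {0..T}" for t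
    unfolding \<tau>1_def \<sigma>_def using even_ext_primitive[OF a m that] by auto
  have \<tau>: "\<tau> t = \<tau>1 t" "\<tau> (4 * T - t) = - \<tau>1 t" if "t \<in> {0..2 * T}" for t
    unfolding \<tau>_def \<tau>1_def q_def using even_ext_primitive[OF a1 m1 that] by auto
  have \<tau>_pieces: "\<tau> (0 + t) = \<sigma> t" "\<tau> (2 * T - t) = - \<sigma> t" "\<tau> (2 * T + t) = \<sigma> t" "\<tau> (4 * T - t) = - \<sigma> t"
    if t: "t \<in> {0..T}" for t
    using \<tau>1[OF t] \<tau>[of t] \<tau>[of "2 * T - t"] t by (auto simp: algebra_simps)
  have \<tau>c: "continuous_on {0..4 * T} \<tau>" by (rule primitive_props(1)[OF qi \<tau>_def])
  have T4: "4 * T > 0" using T by simp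
  \<comment> \<open>Both equations of each pair compute \<open>(U, W)\<close> at \<open>T\<close> (at \<open>3 T\<close>) from its two neighbouring pieces.\<close>
  have match: "c T \<kappa> * U 0 + s T \<kappa> * W 0 = c T \<kappa> * U (2 * T) - s T \<kappa> * W (2 * T)"
     "c' T \<kappa> * U 0 + s' T \<kappa> * W 0 = - (c' T \<kappa> * U (2 * T) - s' T \<kappa> * W (2 * T))"
     "c T \<kappa> * U (2 * T) + s T \<kappa> * W (2 * T) = c T \<kappa> * U (4 * T) - s T \<kappa> * W (4 * T)"
     "c' T \<kappa> * U (2 * T) + s' T \<kappa> * W (2 * T) = - (c' T \<kappa> * U (4 * T) - s' T \<kappa> * W (4 * T))"
    if sys: "reg_system (4 * T) \<tau> \<kappa> U W" for \<kappa> U W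
  proof -
    note dec = reg_system_decompose[OF csys ssys _ TT]
    have "reg_system T \<sigma> \<kappa> (\<lambda>t. U (0 + t)) (\<lambda>t. W (0 + t))"
      by (rule reg_system_shift[OF sys]) (use T \<tau>_pieces in auto)
    note d1 = dec[OF this]
    have "reg_system T \<sigma> \<kappa> (\<lambda>t. U (2 * T - t)) (\<lambda>t. - W (2 * T - t))"
      by (rule reg_system_reflect[OF sys]) (use T \<tau>_pieces in auto)
    note d2 = dec[OF this]
    have "reg_system T \<sigma> \<kappa> (\<lambda>t. U (2 * T + t)) (\<lambda>t. W (2 * T + t))"
      by (rule reg_system_shift[OF sys]) (use T \<tau>_pieces in auto)
    note d3 = dec[OF this]
    have "reg_system T \<sigma> \<kappa> (\<lambda>t. U (4 * T - t)) (\<lambda>t. - W (4 * T - t))"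
      by (rule reg_system_reflect[OF sys]) (use T \<tau>_pieces in auto)
    note d4 = dec[OF this]
    have e: "2 * T - T = T" "2 * T + T = 3 * T" "4 * T - T = 3 * T" by auto
    show "c T \<kappa> * U 0 + s T \<kappa> * W 0 = c T \<kappa> * U (2 * T) - s T \<kappa> * W (2 * T)"
      "c' T \<kappa> * U 0 + s' T \<kappa> * W 0 = - (c' T \<kappa> * U (2 * T) - s' T \<kappa> * W (2 * T))"
      using d1 d2 by (simp_all add: e algebra_simps)
    show "c T \<kappa> * U (2 * T) + s T \<kappa> * W (2 * T) = c T \<kappa> * U (4 * T) - s T \<kappa> * W (4 * T)"
     "c' T \<kappa> * U (2 * T) + s' T \<kappa> * W (2 * T) = - (c' T \<kappa> * U (4 * T) - s' T \<kappa> * W (4 * T))"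
      using d3 d4 by (simp_all add: e algebra_simps)
  qed
  have periodic: "l \<in> eigenvalues bc_periodic (4 * T) q \<longleftrightarrow>
     c T (l + m) = 0 \<or> s T (l + m) = 0 \<or> c' T (l + m) = 0 \<or> s' T (l + m) = 0" for l
  proof
    assume "l \<in> eigenvalues bc_periodic (4 * T) q"
    then obtain U V where UV: "reg_system (4 * T) \<tau> (l + m) U V" "U 0 \<noteq> 0 \<or> V 0 \<noteq> 0"
      "bc_periodic (U 0) (V 0) (U (4 * T)) (V (4 * T))"
      using eigenvalue_iff_reg_system[OF T4 qi m2 \<tau>_def] by blast
    show "c T (l + m) = 0 \<or> s T (l + m) = 0 \<or> c' T (l + m) = 0 \<or> s' T (l + m) = 0"
      using periodic_matching(1)[OF W[OF TT] match[OF UV(1)]] UV(2,3) by (auto simp: bc_periodic_def)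
  next
    assume z: "c T (l + m) = 0 \<or> s T (l + m) = 0 \<or> c' T (l + m) = 0 \<or> s' T (l + m) = 0"
    have ex: "\<exists>U V. reg_system (4 * T) \<tau> (l + m) U V \<and> U 0 = x \<and> V 0 = y" for x y
      using reg_system_exists[OF \<tau>c less_imp_le[OF T4], of x y] by blast
    have "\<exists>U V. reg_system (4 * T) \<tau> (l + m) U V \<and> (U 0 \<noteq> 0 \<or> V 0 \<noteq> 0) \<and> U (4 * T) = U 0 \<and> V (4 * T) = V 0"
    proof (cases "c T (l + m) = 0 \<or> c' T (l + m) = 0")
      case True
      obtain U V where UV: "reg_system (4 * T) \<tau> (l + m) U V" "U 0 = 1" "V 0 = 0" using ex by blast
      then show ?thesis
        using periodic_matching(2)[OF W[OF TT] match[OF UV(1)]] True by (metis zero_neq_one)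
    next
      case False
      then have z': "s T (l + m) = 0 \<or> s' T (l + m) = 0" using z by blast
      obtain U V where UV: "reg_system (4 * T) \<tau> (l + m) U V" "U 0 = 0" "V 0 = 1" using ex by blast
      then show ?thesis
        using periodic_matching(3)[OF W[OF TT] match[OF UV(1)]] z' by (metis zero_neq_one)
    qed
    then show "l \<in> eigenvalues bc_periodic (4 * T) q"
      unfolding eigenvalue_iff_reg_system[OF T4 qi m2 \<tau>_def] bc_periodic_def by metis
  qed
  have "eigenvalues bc_periodic (4 * T) q = range fN \<union> range fD \<union> range fM1 \<union> range fM2"
    unfolding fN(3) fD(3) fM1(3) fM2(3) setN setD setM1 setM2 using periodic by auto
  then show ?thesis
    unfolding ev q_def[symmetric] using order by blast
qed

end
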